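(* For every $k\ge1$ there exists a weighted graph $G=(V,E)$ with SPD depth $O(k)$ (i.e. admitting a shortest path decomposition of depth at most $Ck$ for a universal constant $C$) such that every embedding $f:V\to\ell_1$ of its shortest-path metric has distortion $\Omega\left(\sqrt{k/\log k}\right)$.
   Context: Shortest path decomposition (SPD): a weighted path graph has an SPD of depth $1$; a graph $G$ has an SPD of depth $k$ if there is a shortest path $P$ in $G$ such that every connected component of $G\setminus V(P)$ has an SPD of depth at most $k-1$. The SPD depth of $G$ is the minimum such $k$. The distortion of $f:V\to\ell_1$ is $\tau\rho$, where $\tau,\rho\ge1$ are smallest with $\frac1\tau d_G(x,y)\le\|f(x)-f(y)\|_1\le\rho\,d_G(x,y)$ for all $x,y\in V$. *)

theory Defs
  imports
    Complex_Main
    "HOL-Library.Extended_Nat"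
    "HOL-Library.Extended_Real"
    "Graph_Theory.Digraph_Component"
    "Graph_Theory.Shortest_Path"
begin

section \<open>Weighted graphs\<close>

text \<open>
  Finite simple undirected graphs are symmetric digraphs without loops or parallel arcs,
  so an edge is a pair of opposite arcs and both must carry the same weight.
  Connectedness makes the shortest-path metric finite.
\<close>

locale weighted_graph = pair_graph G for G :: "'a pair_pre_digraph" +
  fixes w :: "('a \<times> 'a) weight_fun"
  assumes connected_G: "connected (with_proj G)"
    and weight_pos: "e \<in> parcs G \<Longrightarrow> 0 < w e"
    and weight_sym: "(u, v) \<in> parcs G \<Longrightarrow> w (u, v) = w (v, u)"

definition sp_dist :: "('a \<times> 'a) weight_fun \<Rightarrow> 'a pair_pre_digraph \<Rightarrow> 'a \<Rightarrow> 'a \<Rightarrow> real" where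
  "sp_dist w G x y = real_of_ereal (wf_digraph.\<mu> (with_proj G) w x y)"


section \<open>Shortest path decompositions\<close>

definition path_graph :: "('a, 'b) pre_digraph \<Rightarrow> bool" where
  "path_graph H \<longleftrightarrow> (\<exists>u p v. pre_digraph.apath H u p v \<and>
     verts H = set (pre_digraph.awalk_verts H u p) \<and>
     arcs_ends H = arc_to_ends H ` set p \<union> (arc_to_ends H ` set p)\<inverse>)"

definition shortest_path ::
    "'b weight_fun \<Rightarrow> ('a, 'b) pre_digraph \<Rightarrow> 'a \<Rightarrow> 'b awalk \<Rightarrow> 'a \<Rightarrow> bool" where
  "shortest_path w H u p v \<longleftrightarrow> pre_digraph.apath H u p v \<and>
     ereal (wf_digraph.awalk_cost w p) = wf_digraph.\<mu> H w u v"

text \<open>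
  In the step, \<^term>\<open>p\<close> is shortest with respect to \<^term>\<open>H\<close> itself, i.e. to the current component
  and not to the original graph. As \<^term>\<open>H\<close> is symmetric, the strongly connected components
  are the connected components; they are non-empty induced subgraphs.
\<close>

inductive has_SPD :: "'b weight_fun \<Rightarrow> ('a, 'b) pre_digraph \<Rightarrow> nat \<Rightarrow> bool"
  for w :: "'b weight_fun" where
  path: "path_graph H \<Longrightarrow> has_SPD w H 1"
| step: "\<lbrakk>1 \<le> k; shortest_path w H u p v;
    \<forall>K \<in> pre_digraph.sccs (H \<restriction> (verts H - set (pre_digraph.awalk_verts H u p))).
      \<exists>j. j \<le> k \<and> has_SPD w K j\<rbrakk>
    \<Longrightarrow> has_SPD w H (k + 1)"

text \<open>The value is \<open>\<infinity>\<close> if there is no shortest path decomposition.\<close>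

definition spd_depth :: "'b weight_fun \<Rightarrow> ('a, 'b) pre_digraph \<Rightarrow> enat" where
  "spd_depth w H = (INF k \<in> {k. has_SPD w H k}. enat k)"


section \<open>Embeddings into \<open>\<ell>\<^sub>1\<close> and their distortion\<close>

definition l1_space :: "(nat \<Rightarrow> real) set" where
  "l1_space = {a. summable (\<lambda>i. \<bar>a i\<bar>)}"

definition l1_norm :: "(nat \<Rightarrow> real) \<Rightarrow> real" where
  "l1_norm a = (\<Sum>i. \<bar>a i\<bar>)"

text \<open>
  The infima are taken in the extended reals, so that a map for which no admissible
  factor exists (a non-injective one, for the first factor) has infinite distortion.
\<close>

definition contraction ::
    "('a \<times> 'a) weight_fun \<Rightarrow> 'a pair_pre_digraph \<Rightarrow> ('a \<Rightarrow> nat \<Rightarrow> real) \<Rightarrow> ereal" where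
  "contraction w G f = (INF \<tau> \<in> {\<tau>::real. 1 \<le> \<tau> \<and>
     (\<forall>x \<in> pverts G. \<forall>y \<in> pverts G.
        1 / \<tau> * sp_dist w G x y \<le> l1_norm (\<lambda>i. f x i - f y i))}. ereal \<tau>)"

definition expansion ::
    "('a \<times> 'a) weight_fun \<Rightarrow> 'a pair_pre_digraph \<Rightarrow> ('a \<Rightarrow> nat \<Rightarrow> real) \<Rightarrow> ereal" where
  "expansion w G f = (INF \<rho> \<in> {\<rho>::real. 1 \<le> \<rho> \<and>
     (\<forall>x \<in> pverts G. \<forall>y \<in> pverts G.
        l1_norm (\<lambda>i. f x i - f y i) \<le> \<rho> * sp_dist w G x y)}. ereal \<rho>)"

definition distortion ::
    "('a \<times> 'a) weight_fun \<Rightarrow> 'a pair_pre_digraph \<Rightarrow> ('a \<Rightarrow> nat \<Rightarrow> real) \<Rightarrow> ereal" where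
  "distortion w G f = contraction w G f * expansion w G f"

end

theory Submission
  imports Defs "HOL-Library.Countable"
begin

text \<open>
  Take a square grid with dyadic subdivisions into squares of side \<open>n * 2 ^ i\<close> for \<open>i < M\<close>, and
  double each of these squares by gluing two copies along the boundary, recursively. Deleting the
  two midlines of a square, which are geodesics because the projection to the plane does not
  increase distances, leaves copies of smaller squares; so there is a shortest path decomposition
  of depth \<open>2 * M + n + 4\<close>.

  Let \<open>f\<close> be an embedding into \<open>\<ell>\<^sub>1\<close>. If in some coordinate a threshold \<open>m\<close> separates the
  two copies of a point \<open>p\<close> of a square, and \<open>f\<close> is monotone along the chords through \<open>p\<close>, then \<open>m\<close>
  also separates the ends \<open>p - v\<close> and \<open>p + v\<close> of each chord that leaves the square, as both copies of
  \<open>p\<close> lie on such a chord. If this also holds for a neighbour \<open>p + u\<close> of \<open>p\<close>, then moving by \<open>2 * u\<close>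
  outside the square does not cross \<open>m\<close>, and going half way round the square in \<open>2 * n\<close> such moves
  leads from \<open>p - v\<close> to \<open>p + v\<close>, a contradiction. Quantitatively, the distance of the two copies
  is bounded by the failure of the triangle inequality to be sharp along \<open>O(n)\<close> chords. Averaged
  over all positions and all choices of copies, this failure telescopes over the scales, which gives
  \<open>M = O(n * \<tau> * \<rho>)\<close> as soon as \<open>n\<close> exceeds a multiple of the distortion \<open>\<tau> * \<rho>\<close>. With
  \<open>M = k\<close> and \<open>n\<close> of order \<open>sqrt k\<close> the distortion is at least of order \<open>sqrt k\<close>.
\<close>

section \<open>Components and shortest path decompositions\<close>

text \<open>All components of \<open>S\<close> are treated at once, so that one deletion step can
  act on every copy of every square.\<close>

definition comps_SPD_le :: "'b weight_fun \<Rightarrow> ('a, 'b) pre_digraph \<Rightarrow> nat \<Rightarrow> 'a set \<Rightarrow> bool" where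
  "comps_SPD_le w G k S \<longleftrightarrow> (\<forall>K \<in> pre_digraph.sccs (G \<restriction> S). \<exists>j\<le>k. has_SPD w K j)"

lemma induce_induce: "T \<subseteq> S \<Longrightarrow> (G \<restriction> S) \<restriction> T = G \<restriction> T"
  by (auto simp: induce_subgraph_def)

context wf_digraph
begin

lemma sccs_induce:
  "pre_digraph.sccs (G \<restriction> S) = (\<lambda>T. G \<restriction> T) ` pre_digraph.sccs_verts (G \<restriction> S)"
proof -
  interpret S: wf_digraph "G \<restriction> S" by auto
  have "T \<subseteq> S" if "T \<in> S.sccs_verts" for T
    using S.sccs_verts_subsets[OF that] by simp
  then show ?thesis
    unfolding S.sccs_conv_sccs_verts by (auto simp: induce_induce image_iff)
qed

lemma sccs_verts_induce_subset: "T \<in> pre_digraph.sccs_verts (G \<restriction> S) \<Longrightarrow> T \<subseteq> S"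
  using wf_digraph.sccs_verts_subsets[OF wellformed_induce_subgraph] by force

lemma reachable_induce_closed:
  assumes "U \<subseteq> S" and closed: "\<And>u v. u \<in> U \<Longrightarrow> v \<in> S \<Longrightarrow> (u, v) \<in> arcs_ends G \<Longrightarrow> v \<in> U"
    and u: "u \<in> U" and r: "u \<rightarrow>\<^sup>*\<^bsub>G \<restriction> S\<^esub> v"
  shows "v \<in> U \<and> u \<rightarrow>\<^sup>*\<^bsub>G \<restriction> U\<^esub> v"
proof -
  interpret S: wf_digraph "G \<restriction> S" by auto
  interpret U: wf_digraph "G \<restriction> U" by auto
  from r show ?thesis
  proof (induct rule: S.reachable_induct)
    case base
    then show ?case using u by auto
  next
    case (step x y)
    then have y: "y \<in> S" "(x, y) \<in> arcs_ends G"
      using S.adj_in_verts(2)[OF step(2)] dominates_induce_subgraphD[OF step(2)] by auto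
    then have "y \<in> U" using closed step by auto
    moreover have "x \<rightarrow>\<^bsub>G \<restriction> U\<^esub> y"
      using step \<open>y \<in> U\<close> \<open>(x, y) \<in> arcs_ends G\<close> by (auto simp: arcs_ends_def arc_to_ends_def image_iff)
    ultimately show ?case using step U.reachable_adj_trans by blast
  qed
qed

text \<open>No arc inside \<open>S\<close> leaves \<open>U\<close>, so walks in \<open>S\<close>
  from \<open>U\<close> stay in \<open>U\<close>, and reachability from \<open>U\<close> is the same
  in both subgraphs.\<close>

lemma sccs_verts_induce_closed:
  assumes "U \<subseteq> S" and "\<And>u v. u \<in> U \<Longrightarrow> v \<in> S \<Longrightarrow> (u, v) \<in> arcs_ends G \<Longrightarrow> v \<in> U" and "T \<subseteq> U"
  shows "T \<in> pre_digraph.sccs_verts (G \<restriction> S) \<longleftrightarrow> T \<in> pre_digraph.sccs_verts (G \<restriction> U)"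
proof -
  have eq: "u \<rightarrow>\<^sup>*\<^bsub>G \<restriction> S\<^esub> v \<longleftrightarrow> u \<rightarrow>\<^sup>*\<^bsub>G \<restriction> U\<^esub> v" if "u \<in> U" for u v
    using reachable_induce_closed[of U S u v] assms(1,2) that reachable_induce_ss[of U u v S] by blast
  have inU: "v \<in> U" if "u \<in> U" "u \<rightarrow>\<^sup>*\<^bsub>G \<restriction> S\<^esub> v" for u v
    using reachable_induce_closed[of U S u v] assms(1,2) that by blast
  have out: "(\<not> u \<rightarrow>\<^sup>*\<^bsub>G \<restriction> S\<^esub> v \<or> \<not> v \<rightarrow>\<^sup>*\<^bsub>G \<restriction> S\<^esub> u) \<longleftrightarrow>
      (\<not> u \<rightarrow>\<^sup>*\<^bsub>G \<restriction> U\<^esub> v \<or> \<not> v \<rightarrow>\<^sup>*\<^bsub>G \<restriction> U\<^esub> u)" if "u \<in> U" for u v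
    using eq[of u v] eq[of v u] inU[of u v] that by (cases "v \<in> U") auto
  have "(\<forall>u\<in>T. \<forall>v\<in>T. u \<rightarrow>\<^sup>*\<^bsub>G \<restriction> S\<^esub> v) \<longleftrightarrow> (\<forall>u\<in>T. \<forall>v\<in>T. u \<rightarrow>\<^sup>*\<^bsub>G \<restriction> U\<^esub> v)"
    by (intro ball_cong refl eq subsetD[OF \<open>T \<subseteq> U\<close>])
  moreover have "(\<forall>u\<in>T. \<forall>v. v \<notin> T \<longrightarrow> \<not> u \<rightarrow>\<^sup>*\<^bsub>G \<restriction> S\<^esub> v \<or> \<not> v \<rightarrow>\<^sup>*\<^bsub>G \<restriction> S\<^esub> u) \<longleftrightarrow>
      (\<forall>u\<in>T. \<forall>v. v \<notin> T \<longrightarrow> \<not> u \<rightarrow>\<^sup>*\<^bsub>G \<restriction> U\<^esub> v \<or> \<not> v \<rightarrow>\<^sup>*\<^bsub>G \<restriction> U\<^esub> u)"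
    by (intro ball_cong refl all_cong out subsetD[OF \<open>T \<subseteq> U\<close>])
  ultimately show ?thesis unfolding pre_digraph.sccs_verts_def by simp
qed

end

lemma (in sym_digraph) sccs_verts_induce_adj_closed:
  assumes T: "T \<in> pre_digraph.sccs_verts (G \<restriction> S)" and "u \<in> T" "v \<in> S" and uv: "(u, v) \<in> arcs_ends G"
  shows "v \<in> T"
proof -
  interpret S: wf_digraph "G \<restriction> S" by auto
  have "u \<in> S" using T assms sccs_verts_induce_subset by auto
  then have "u \<rightarrow>\<^bsub>G \<restriction> S\<^esub> v" "v \<rightarrow>\<^bsub>G \<restriction> S\<^esub> u"
    using \<open>v \<in> S\<close> uv graph_symmetric[OF uv]
    by (auto simp: arcs_ends_def arc_to_ends_def image_iff)
  then show ?thesis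
    using T \<open>u \<in> T\<close> S.reachable_adjI unfolding pre_digraph.sccs_verts_def by blast
qed

lemma (in wf_digraph) awalk_cost_ge_Lipschitz:
  assumes "\<And>e. e \<in> arcs G \<Longrightarrow> \<phi> (head G e) - \<phi> (tail G e) \<le> w e" and "awalk u p v"
  shows "\<phi> v - \<phi> u \<le> awalk_cost w p"
  using assms(2)
proof (induct p arbitrary: u)
  case Nil
  then show ?case by (auto simp: awalk_Nil_iff)
next
  case (Cons e p)
  then have "e \<in> arcs G" "u = tail G e" "awalk (head G e) p v"
    by (auto simp: awalk_Cons_iff)
  with Cons(1)[of "head G e"] assms(1)[of e] show ?case by auto
qed

lemma (in wf_digraph) \<mu>_ge_Lipschitz:
  assumes "\<And>e. e \<in> arcs G \<Longrightarrow> \<phi> (head G e) - \<phi> (tail G e) \<le> w e"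
  shows "ereal (\<phi> v - \<phi> u) \<le> \<mu> w u v"
  unfolding \<mu>_def using awalk_cost_ge_Lipschitz[OF assms] by (intro INF_greatest) auto

section \<open>Deletion of geodesic segments\<close>

context pair_sym_digraph
begin

definition segment :: "(nat \<Rightarrow> 'a) \<Rightarrow> nat \<Rightarrow> nat \<Rightarrow> ('a \<times> 'a) list" where
  "segment g i m = map (\<lambda>t. (g t, g (Suc t))) [i..<i + m]"

lemma segment_Suc: "segment g i (Suc m) = (g i, g (Suc i)) # segment g (Suc i) m"
  unfolding segment_def by (subst upt_conv_Cons) auto

lemma pawalk_verts_segment: "pawalk_verts (g i) (segment g i m) = map g [i..<Suc (i + m)]"
proof (induct m arbitrary: i)
  case 0
  then show ?case by (simp add: segment_def)
next
  case (Suc m)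
  show ?case unfolding segment_Suc using Suc[of "Suc i"]
    by (simp add: upt_conv_Cons[of i] del: upt_Suc)
qed

text \<open>The potential \<open>\<xi>\<close> grows by 1 along each arc of the segment and by at
  most 1 along any arc, so no walk between its ends is cheaper than the segment. The same growth
  makes \<open>g\<close> injective.\<close>

lemma shortest_path_segment:
  assumes T: "g ` {..m} \<subseteq> T"
    and arcs: "\<And>t. t < m \<Longrightarrow> (g t, g (Suc t)) \<in> parcs G"
    and Lip: "\<And>u v. (u, v) \<in> parcs G \<Longrightarrow> \<xi> v - \<xi> u \<le> (1::int)"
    and straight: "\<And>t. t \<le> m \<Longrightarrow> \<xi> (g t) = \<xi> (g 0) + int t"
  shows "shortest_path (\<lambda>_. 1) (with_proj G \<restriction> T) (g 0) (segment g 0 m) (g m)"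
    and "set (pre_digraph.awalk_verts (with_proj G \<restriction> T) (g 0) (segment g 0 m)) = g ` {..m}"
proof -
  interpret T: wf_digraph "with_proj G \<restriction> T" by auto
  have verts: "T.awalk_verts u p = pawalk_verts u p" for u p
    by (simp add: awalk_verts_induce)
  show "set (T.awalk_verts (g 0) (segment g 0 m)) = g ` {..m}"
    by (simp only: verts pawalk_verts_segment) (auto simp: less_Suc_eq_le simp del: upt_Suc)
  have "i + l \<le> m \<Longrightarrow> T.awalk (g i) (segment g i l) (g (i + l))" for i l
  proof (induct l arbitrary: i)
    case 0
    then show ?case using T by (auto simp: segment_def T.awalk_Nil_iff)
  next
    case (Suc l)
    have "g i \<in> T" "g (Suc i) \<in> T" using T Suc(2) by auto
    moreover have "T.awalk (g (Suc i)) (segment g (Suc i) l) (g (i + Suc l))"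
      using Suc(1)[of "Suc i"] Suc(2) by simp
    ultimately show ?case using arcs[of i] Suc(2)
      unfolding segment_Suc T.awalk_Cons_iff by simp
  qed
  from this[of 0 m] have walk: "T.awalk (g 0) (segment g 0 m) (g m)"
    by (simp only: add_0 order_refl simp_thms)
  have "inj_on g {..m}"
  proof (rule inj_onI)
    fix s t assume st: "s \<in> {..m}" "t \<in> {..m}" "g s = g t"
    have "\<xi> (g 0) + int s = \<xi> (g s)" using straight[of s] st(1) by (simp only: atMost_iff)
    also have "\<dots> = \<xi> (g 0) + int t" using straight[of t] st(2) by (simp only: st(3) atMost_iff)
    finally show "s = t" by simp
  qed
  then have "distinct (T.awalk_verts (g 0) (segment g 0 m))"
    unfolding verts pawalk_verts_segment
    by (auto simp: distinct_map less_Suc_eq_le atMost_def simp del: upt_Suc elim!: inj_on_subset)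
  with walk have path: "T.apath (g 0) (segment g 0 m) (g m)" by (simp add: T.apath_def)
  have cost: "T.awalk_cost (\<lambda>_. 1) (segment g 0 m) = real m"
    by (simp add: T.awalk_cost_def segment_def map_replicate_const sum_list_replicate)
  have "real_of_int (\<xi> (snd e)) - real_of_int (\<xi> (fst e)) \<le> 1" if "e \<in> parcs G" for e
    using Lip[of "fst e" "snd e"] that by simp
  then have "ereal (real_of_int (\<xi> (g m)) - real_of_int (\<xi> (g 0))) \<le> T.\<mu> (\<lambda>_. 1) (g 0) (g m)"
    by (intro T.\<mu>_ge_Lipschitz[where \<phi>="\<lambda>v. real_of_int (\<xi> v)"]) simp
  then have "ereal (real m) \<le> T.\<mu> (\<lambda>_. 1) (g 0) (g m)"
    using straight[of m] by simp
  moreover have "T.\<mu> (\<lambda>_. 1) (g 0) (g m) \<le> ereal (real m)"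
    using T.min_cost_le_walk_cost[OF walk, of "\<lambda>_. 1"] by (simp add: cost)
  ultimately show "shortest_path (\<lambda>_. 1) (with_proj G \<restriction> T) (g 0) (segment g 0 m) (g m)"
    unfolding shortest_path_def cost using path by auto
qed

text \<open>
  The label \<open>c\<close> separates components, so that one segment in each of many components is deleted
  in a single step; \<open>\<xi>\<close> certifies that the segments are geodesics of whatever subgraph they lie in.
\<close>

lemma comps_SPD_le_step:
  assumes S: "S \<subseteq> pverts G" and "1 \<le> k" and rest: "comps_SPD_le (\<lambda>_. 1) (with_proj G) k (S - D)"
    and c: "\<And>u v. (u, v) \<in> parcs G \<Longrightarrow> u \<in> S \<Longrightarrow> v \<in> S \<Longrightarrow> c u = c v"
    and Lip: "\<And>u v. (u, v) \<in> parcs G \<Longrightarrow> \<xi> v - \<xi> u \<le> (1::int)"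
    and D: "\<And>d. d \<in> D \<inter> S \<Longrightarrow> \<exists>g m. {v \<in> D \<inter> S. c v = c d} = g ` {..m::nat} \<and>
      (\<forall>t<m. (g t, g (Suc t)) \<in> parcs G) \<and> (\<forall>t\<le>m. \<xi> (g t) = \<xi> (g 0) + int t)"
  shows "comps_SPD_le (\<lambda>_. 1) (with_proj G) (k + 1) S"
  unfolding comps_SPD_le_def sccs_induce ball_simps
proof (rule ballI)
  fix T assume T: "T \<in> pre_digraph.sccs_verts (with_proj G \<restriction> S)"
  have TS: "T \<subseteq> S" using T by (rule sccs_verts_induce_subset)
  have closed: "v \<in> T" if "u \<in> T" "v \<in> S" "(u, v) \<in> parcs G" for u v
    using sccs_verts_induce_adj_closed[OF T] that by auto
  have comp: "\<exists>j\<le>k. has_SPD (\<lambda>_. 1) (with_proj G \<restriction> K) j"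
    if K: "K \<in> pre_digraph.sccs_verts (with_proj G \<restriction> (T - D))" for K
  proof -
    have KT: "K \<subseteq> T - D" using K by (rule sccs_verts_induce_subset)
    have "K \<in> pre_digraph.sccs_verts (with_proj G \<restriction> (S - D))"
      by (rule iffD2[OF sccs_verts_induce_closed[OF _ _ KT] K]) (use TS closed in auto)
    then show ?thesis using rest unfolding comps_SPD_le_def sccs_induce by blast
  qed
  show "\<exists>j\<le>k + 1. has_SPD (\<lambda>_. 1) (with_proj G \<restriction> T) j"
  proof (cases "T \<inter> D = {}")
    case True
    \<comment> \<open>A component that misses \<open>D\<close> survives the deletion
      unchanged.\<close>
    have "T \<in> pre_digraph.sccs_verts (with_proj G \<restriction> T)"
      by (rule iffD1[OF sccs_verts_induce_closed[OF TS _ order_refl] T]) (use closed in auto)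
    moreover have "T - D = T" using True by auto
    ultimately show ?thesis using comp[of T] by (auto intro: le_SucI)
  next
    case False
    then obtain d where d: "d \<in> T" "d \<in> D" by auto
    with TS D[of d] obtain g and m :: nat where g: "{v \<in> D \<inter> S. c v = c d} = g ` {..m}"
      "\<And>t. t < m \<Longrightarrow> (g t, g (Suc t)) \<in> parcs G" "\<And>t. t \<le> m \<Longrightarrow> \<xi> (g t) = \<xi> (g 0) + int t"
      by blast
    have gS: "g t \<in> S" if "t \<le> m" for t using g(1) that by blast
    obtain t0 where t0: "t0 \<le> m" "d = g t0" using g(1) d TS by blast
    \<comment> \<open>From \<open>d\<close> the segment is followed in both directions; it cannot
      leave \<open>T\<close>, which is closed under adjacency in \<open>S\<close>.\<close>
    have down: "l \<le> t0 \<Longrightarrow> g (t0 - l) \<in> T" for l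
    proof (induct l)
      case 0
      then show ?case using d t0 by simp
    next
      case (Suc l)
      have "Suc (t0 - Suc l) = t0 - l" using Suc by simp
      then have "(g (t0 - l), g (t0 - Suc l)) \<in> parcs G"
        using g(2)[of "t0 - Suc l"] arcs_symmetric Suc t0 by auto
      then show ?case using Suc t0 closed gS[of "t0 - Suc l"] by auto
    qed
    have up: "t0 + l \<le> m \<Longrightarrow> g (t0 + l) \<in> T" for l
    proof (induct l)
      case 0
      then show ?case using d t0 by simp
    next
      case (Suc l)
      then show ?case using closed[OF _ gS g(2)[of "t0 + l"]] by auto
    qed
    have gT: "g ` {..m} \<subseteq> T"
    proof safe
      fix t assume "t \<le> m"
      then show "g t \<in> T" using down[of "t0 - t"] up[of "t - t0"] by (cases "t \<le> t0") auto
    qed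
    have same: "c v = c d" if "v \<in> T" for v
    proof -
      have r: "d \<rightarrow>\<^sup>*\<^bsub>with_proj G \<restriction> S\<^esub> v"
        using T d that unfolding pre_digraph.sccs_verts_def by auto
      interpret S: wf_digraph "with_proj G \<restriction> S" by auto
      from r show ?thesis
      proof (induct rule: S.reachable_induct)
        case (step x y)
        then have "(x, y) \<in> parcs G" "x \<in> S" "y \<in> S"
          by (auto simp: arcs_ends_def arc_to_ends_def)
        then show ?case using c step by simp
      qed simp
    qed
    \<comment> \<open>The label is constant on \<open>T\<close>, so this one segment is all that
      \<open>D\<close> removes from \<open>T\<close>.\<close>
    have TD: "T - g ` {..m} = T - D"
      using gT g(1) same TS by blast
    note sp = shortest_path_segment[OF gT g(2) Lip g(3)]
    have "has_SPD (\<lambda>_. 1) (with_proj G \<restriction> T) (k + 1)"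
    proof (rule has_SPD.step[OF \<open>1 \<le> k\<close> sp(1)])
      have "(with_proj G \<restriction> T) \<restriction> (T - D) = with_proj G \<restriction> (T - D)"
        by (rule induce_induce) auto
      then show "\<forall>K\<in>pre_digraph.sccs ((with_proj G \<restriction> T) \<restriction> (verts (with_proj G \<restriction> T) -
          set (pre_digraph.awalk_verts (with_proj G \<restriction> T) (g 0) (segment g 0 m)))).
          \<exists>j\<le>k. has_SPD (\<lambda>_. 1) K j"
        by (auto simp: sp(2) TD sccs_induce intro: comp)
    qed auto
    then show ?thesis by blast
  qed
qed

lemma comps_SPD_le_empty: "comps_SPD_le w (with_proj G) k {}"
proof -
  have False if T: "T \<in> pre_digraph.sccs_verts (with_proj G \<restriction> {})" for T
    using sccs_verts_induce_subset[OF T] T unfolding pre_digraph.sccs_verts_def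
    by (simp only: mem_Collect_eq subset_empty simp_thms)
  then show ?thesis unfolding comps_SPD_le_def sccs_induce by (metis (no_types, lifting) imageE)
qed

lemma comps_SPD_le_imp_has_SPD:
  assumes "comps_SPD_le w (with_proj G) k (pverts G)" "connected (with_proj G)"
  shows "\<exists>j\<le>k. has_SPD w (with_proj G) j"
proof -
  have "with_proj G \<restriction> pverts G = with_proj G"
    unfolding induce_subgraph_def with_proj_def using in_arcsD1 in_arcsD2 by auto
  moreover have "strongly_connected (with_proj G)"
    using assms(2) reachable_mk_symmetric_eq[OF pair_sym_arcs]
    unfolding connected_def strongly_connected_def by simp
  then have "with_proj G \<in> sccs"
    by (auto simp: sccs_def intro: induced_subgraph_refl
        dest!: induced_imp_subgraph dest: subgraph_imp_subverts[THEN subsetD])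
  ultimately show ?thesis using assms(1) unfolding comps_SPD_le_def by metis
qed

end

section \<open>The space \<open>\<ell>\<^sub>1\<close>\<close>

abbreviation l1_dist :: "(nat \<Rightarrow> real) \<Rightarrow> (nat \<Rightarrow> real) \<Rightarrow> real" where
  "l1_dist a b \<equiv> l1_norm (\<lambda>i. a i - b i)"

lemma summable_l1_diff:
  assumes "a \<in> l1_space" "b \<in> l1_space"
  shows "summable (\<lambda>i. \<bar>a i - b i\<bar>)"
proof (rule summable_comparison_test')
  show "summable (\<lambda>i. \<bar>a i\<bar> + \<bar>b i\<bar>)"
    using assms by (auto simp: l1_space_def intro: summable_add)
  show "norm \<bar>a n - b n\<bar> \<le> \<bar>a n\<bar> + \<bar>b n\<bar>" for n by simp
qed

lemma l1_dist_nonneg: "a \<in> l1_space \<Longrightarrow> b \<in> l1_space \<Longrightarrow> 0 \<le> l1_dist a b"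
  unfolding l1_norm_def by (intro suminf_nonneg summable_l1_diff) auto

lemma l1_dist_commute: "l1_dist a b = l1_dist b a"
  by (simp add: l1_norm_def abs_minus_commute)

lemma l1_dist_triangle:
  assumes "a \<in> l1_space" "b \<in> l1_space" "c \<in> l1_space"
  shows "l1_dist a c \<le> l1_dist a b + l1_dist b c"
  unfolding l1_norm_def suminf_add[OF summable_l1_diff summable_l1_diff, OF assms(1,2,2,3)]
  by (intro suminf_le summable_add summable_l1_diff assms) auto

section \<open>Excess along chords around two sheets\<close>

text \<open>One coordinate: \<open>a j\<close> and \<open>b j\<close> are the ends of chord
  \<open>j\<close>, \<open>c j\<close> and \<open>c' j\<close> the two copies of its centre. If the
  bound failed, a threshold halfway between \<open>g\<close> and \<open>g'\<close> would separate
  the ends of every chord. Consecutive chords share an end, so \<open>b 0\<close> and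
  \<open>b (2 * L)\<close> would be on the same side; but \<open>b (2 * L) = a 0\<close> is the
  other end of chord 0.\<close>

lemma chord_chain_real_aux:
  fixes a b c c' :: "nat \<Rightarrow> real"
  assumes a: "\<And>k. k < L \<Longrightarrow> a (2 * k + 1) = a (2 * k)"
    and b: "\<And>k. k < L \<Longrightarrow> b (2 * k + 1) = b (2 * k + 2)"
    and ba: "b (2 * L) = a 0"
    and c: "\<And>j. j \<le> 2 * L \<Longrightarrow> \<bar>c j - g\<bar> \<le> e" "\<And>j. j \<le> 2 * L \<Longrightarrow> \<bar>c' j - g'\<bar> \<le> e"
    and le: "g \<le> g'"
  shows "\<bar>g - g'\<bar> \<le> (\<Sum>j\<le>2 * L. \<bar>a j - c j\<bar> + \<bar>c j - b j\<bar> - \<bar>a j - b j\<bar>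
    + (\<bar>a j - c' j\<bar> + \<bar>c' j - b j\<bar> - \<bar>a j - b j\<bar>)) + 2 * e"
    (is "_ \<le> (\<Sum>j\<le>_. ?ex j) + _")
proof (rule ccontr)
  assume "\<not> ?thesis"
  then have big: "(\<Sum>j\<le>2 * L. ?ex j) < g' - g - 2 * e" using le by simp
  define m where "m = (g + g') / 2"
  have flip: "a j < m \<longleftrightarrow> \<not> b j < m" if "j \<le> 2 * L" for j
  proof -
    have "?ex j \<le> (\<Sum>j\<le>2 * L. ?ex j)"
      using that by (intro member_le_sum; linarith?) auto
    then have "?ex j < g' - g - 2 * e" using big by linarith
    moreover have "\<bar>c j - g\<bar> \<le> e" "\<bar>c' j - g'\<bar> \<le> e" using c that by auto
    then have "2 * (m - c j) \<ge> g' - g - 2 * e" "2 * (c' j - m) \<ge> g' - g - 2 * e"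
      unfolding m_def by (auto simp: field_simps)
    moreover have "0 \<le> \<bar>a j - c j\<bar> + \<bar>c j - b j\<bar> - \<bar>a j - b j\<bar>"
      "0 \<le> \<bar>a j - c' j\<bar> + \<bar>c' j - b j\<bar> - \<bar>a j - b j\<bar>"
      by linarith+
    \<comment> \<open>If both ends lie on one side of \<open>m\<close>, the detour through the copy
      on the other side costs at least twice its distance from \<open>m\<close>.\<close>
    moreover have "2 * (m - c j) \<le> \<bar>a j - c j\<bar> + \<bar>c j - b j\<bar> - \<bar>a j - b j\<bar>"
      if "\<not> a j < m" "\<not> b j < m" using that by (auto simp: abs_if)
    moreover have "2 * (c' j - m) \<le> \<bar>a j - c' j\<bar> + \<bar>c' j - b j\<bar> - \<bar>a j - b j\<bar>"
      if "a j < m" "b j < m" using that by (auto simp: abs_if)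
    ultimately show ?thesis by argo
  qed
  have "j \<le> L \<Longrightarrow> (b (2 * j) < m \<longleftrightarrow> b 0 < m)" for j
  proof (induct j)
    case (Suc j)
    then show ?case
      using flip[of "2 * j"] flip[of "2 * j + 1"] a[of j] b[of j] by simp
  qed simp
  from this[of L] show False using flip[of 0] ba by auto
qed

lemma chord_chain_real:
  fixes a b c c' :: "nat \<Rightarrow> real"
  assumes "\<And>k. k < L \<Longrightarrow> a (2 * k + 1) = a (2 * k)"
    and "\<And>k. k < L \<Longrightarrow> b (2 * k + 1) = b (2 * k + 2)" and "b (2 * L) = a 0"
    and "\<And>j. j \<le> 2 * L \<Longrightarrow> \<bar>c j - g\<bar> \<le> e" "\<And>j. j \<le> 2 * L \<Longrightarrow> \<bar>c' j - g'\<bar> \<le> e"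
  shows "\<bar>g - g'\<bar> \<le> (\<Sum>j\<le>2 * L. \<bar>a j - c j\<bar> + \<bar>c j - b j\<bar> - \<bar>a j - b j\<bar>
    + (\<bar>a j - c' j\<bar> + \<bar>c' j - b j\<bar> - \<bar>a j - b j\<bar>)) + 2 * e"
proof (cases "g \<le> g'")
  case True
  show ?thesis by (rule chord_chain_real_aux[OF assms True])
next
  case False
  then show ?thesis
    using chord_chain_real_aux[OF assms(1-3,5,4)] by (simp add: abs_minus_commute add.commute)
qed

text \<open>The real estimate holds in each coordinate and is summed. \<open>z\<close> and
  \<open>z'\<close> list a centre and its two translates on the two sheets,
  \<open>\<sigma> j\<close> selects the one on chord \<open>j\<close>, and the deviations of the
  translates together serve as \<open>e\<close>.\<close>

lemma chord_chain_l1: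
  fixes a b :: "nat \<Rightarrow> nat \<Rightarrow> real" and z z' :: "nat \<Rightarrow> nat \<Rightarrow> real" and \<sigma> :: "nat \<Rightarrow> nat"
  assumes a: "\<And>k. k < L \<Longrightarrow> a (2 * k + 1) = a (2 * k)"
    and b: "\<And>k. k < L \<Longrightarrow> b (2 * k + 1) = b (2 * k + 2)" and ba: "b (2 * L) = a 0"
    and \<sigma>: "\<And>j. j \<le> 2 * L \<Longrightarrow> \<sigma> j \<le> 2"
    and l1: "\<And>j. a j \<in> l1_space" "\<And>j. b j \<in> l1_space" "\<And>s. z s \<in> l1_space" "\<And>s. z' s \<in> l1_space"
  shows "l1_dist (z 0) (z' 0) \<le> (\<Sum>j\<le>2 * L.
      l1_dist (a j) (z (\<sigma> j)) + l1_dist (z (\<sigma> j)) (b j) - l1_dist (a j) (b j)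
      + (l1_dist (a j) (z' (\<sigma> j)) + l1_dist (z' (\<sigma> j)) (b j) - l1_dist (a j) (b j)))
    + 2 * (l1_dist (z 1) (z 0) + l1_dist (z 2) (z 0) + l1_dist (z' 1) (z' 0) + l1_dist (z' 2) (z' 0))"
    (is "_ \<le> ?R")
proof -
  define r where "r i = (\<Sum>j\<le>2 * L. \<bar>a j i - z (\<sigma> j) i\<bar> + \<bar>z (\<sigma> j) i - b j i\<bar> - \<bar>a j i - b j i\<bar>
      + (\<bar>a j i - z' (\<sigma> j) i\<bar> + \<bar>z' (\<sigma> j) i - b j i\<bar> - \<bar>a j i - b j i\<bar>))
    + 2 * (\<bar>z 1 i - z 0 i\<bar> + \<bar>z 2 i - z 0 i\<bar> + \<bar>z' 1 i - z' 0 i\<bar> + \<bar>z' 2 i - z' 0 i\<bar>)" for i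
  have s: "(\<lambda>i. \<bar>x i - y i\<bar>) sums l1_dist x y" if "x \<in> l1_space" "y \<in> l1_space" for x y
    using summable_l1_diff[OF that] by (simp add: l1_norm_def summable_sums)
  have r: "r sums ?R"
    unfolding r_def by (intro sums_add sums_sum sums_diff sums_mult s l1)
  have "\<bar>z 0 i - z' 0 i\<bar> \<le> r i" for i
  proof -
    define e where "e = \<bar>z 1 i - z 0 i\<bar> + \<bar>z 2 i - z 0 i\<bar> + \<bar>z' 1 i - z' 0 i\<bar> + \<bar>z' 2 i - z' 0 i\<bar>"
    have "\<sigma> j = 0 \<or> \<sigma> j = 1 \<or> \<sigma> j = 2" if "j \<le> 2 * L" for j using \<sigma>[OF that] by linarith
    then have "\<bar>z (\<sigma> j) i - z 0 i\<bar> \<le> e" "\<bar>z' (\<sigma> j) i - z' 0 i\<bar> \<le> e" if "j \<le> 2 * L" for j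
      using that unfolding e_def by fastforce+
    then show ?thesis unfolding r_def e_def[symmetric]
      using a b ba by (intro chord_chain_real) auto
  qed
  then show ?thesis
    using sums_le[OF _ s[OF l1(3,4)] r] by blast
qed

section \<open>Sums over a discrete torus\<close>

lemma sum_shift_periodic:
  fixes h :: "int \<Rightarrow> real"
  assumes per: "\<And>x. h (x + P) = h x" and P: "0 < P"
  shows "(\<Sum>x\<in>{0..<P}. h (x + s)) = (\<Sum>x\<in>{0..<P}. h x)"
proof -
  have up: "h (x + P * int k) = h x" for x k
  proof (induct k)
    case (Suc k)
    have "h (x + P * int (Suc k)) = h (x + P * int k + P)" by (simp add: algebra_simps)
    then show ?case using Suc per by simp
  qed simp
  have mult: "h (x + P * k) = h x" for x k
  proof (cases "0 \<le> k")
    case True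
    then show ?thesis using up[of x "nat k"] by simp
  next
    case False
    then show ?thesis using up[of "x + P * k" "nat (- k)"] by simp
  qed
  have "h x = h (x mod P)" for x
    using mult[of "x mod P" "x div P"] by (simp add: add.commute)
  then have "(\<Sum>x\<in>{0..<P}. h (x + s)) = (\<Sum>x\<in>{0..<P}. h ((x + s) mod P))" by (intro sum.cong) auto
  also have "\<dots> = (\<Sum>x\<in>{0..<P}. h x)"
  proof (rule sum.reindex_bij_witness[where i="\<lambda>x. (x - s) mod P" and j="\<lambda>x. (x + s) mod P"])
    fix x assume "x \<in> {0..<P}"
    then show "((x + s) mod P - s) mod P = x" "((x - s) mod P + s) mod P = x"
      by (simp_all add: mod_simps)
  qed (use P in auto)
  finally show ?thesis .
qed

lemma sum2_shift_periodic:
  fixes h :: "int \<Rightarrow> int \<Rightarrow> real"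
  assumes "\<And>x y. h (x + P) y = h x y" "\<And>x y. h x (y + P) = h x y" and "0 < P"
  shows "(\<Sum>x\<in>{0..<P}. \<Sum>y\<in>{0..<P}. h (x + s) (y + t)) = (\<Sum>x\<in>{0..<P}. \<Sum>y\<in>{0..<P}. h x y)"
proof -
  have "(\<Sum>x\<in>{0..<P}. \<Sum>y\<in>{0..<P}. h (x + s) (y + t)) = (\<Sum>x\<in>{0..<P}. \<Sum>y\<in>{0..<P}. h (x + s) y)"
    using assms by (intro sum.cong refl sum_shift_periodic)
  also have "\<dots> = (\<Sum>x\<in>{0..<P}. \<Sum>y\<in>{0..<P}. h x y)"
    using assms by (intro sum_shift_periodic[where h="\<lambda>x. \<Sum>y\<in>{0..<P}. h x y"]) auto
  finally show ?thesis .
qed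

text \<open>Translation by half of \<open>H\<close> exchanges the middle half of each period with
  its complement, so exactly one of \<open>x\<close> and its translate is counted.\<close>

lemma card_middle_half:
  fixes H P :: int
  assumes H: "0 < H" "4 dvd H" and P: "0 < P" "H dvd P"
  shows "2 * real (card {x \<in> {0..<P}. H div 4 \<le> x mod H \<and> x mod H < 3 * (H div 4)}) = real_of_int P"
proof -
  define h :: "int \<Rightarrow> real" where "h x = of_bool (H div 4 \<le> x mod H \<and> x mod H < 3 * (H div 4))" for x
  obtain q where q: "H = 4 * q" using H by auto
  have per: "h (x + P) = h x" for x
    using P by (auto simp: h_def)
  have half: "h x + h (x + 2 * q) = 1" for x
  proof -
    have r: "0 \<le> x mod H" "x mod H < H" using H by auto
    have m: "(x + 2 * q) mod H = (x mod H + 2 * q) mod H" by (simp add: mod_simps)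
    show ?thesis
    proof (cases "x mod H < 2 * q")
      case True
      then have "(x + 2 * q) mod H = x mod H + 2 * q"
        unfolding m using r q by (intro mod_pos_pos_trivial) auto
      then show ?thesis using True r q by (auto simp: h_def)
    next
      case False
      have "(x mod H + 2 * q) mod H = (x mod H + 2 * q - H) mod H" by simp
      also have "\<dots> = x mod H + 2 * q - H"
        using False r q by (intro mod_pos_pos_trivial) auto
      finally show ?thesis using False r q m by (auto simp: h_def)
    qed
  qed
  have "2 * (\<Sum>x\<in>{0..<P}. h x) = (\<Sum>x\<in>{0..<P}. h x + h (x + 2 * q))"
    unfolding sum.distrib using sum_shift_periodic[of h P "2 * q"] per P by simp
  also have "\<dots> = real_of_int P" using half P by simp
  finally show ?thesis by (simp add: h_def sum.If_cases Int_def of_bool_def)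
qed

section \<open>Distances in weighted graphs\<close>

context weighted_graph
begin

lemma reachable_verts: "u \<in> pverts G \<Longrightarrow> v \<in> pverts G \<Longrightarrow> u \<rightarrow>\<^sup>*\<^bsub>with_proj G\<^esub> v"
  using connected_G reachable_mk_symmetric_eq[OF pair_sym_arcs]
  unfolding connected_def strongly_connected_def by simp

lemma \<mu>_real:
  assumes "u \<in> pverts G" "v \<in> pverts G"
  shows "\<mu> w u v = ereal (sp_dist w G u v)"
proof -
  have "\<mu> w u v < \<infinity>" using reachable_verts[OF assms] by (simp only: \<mu>_reach_conv)
  moreover have "ereal (0 - 0) \<le> \<mu> w u v"
    using weight_pos by (intro \<mu>_ge_Lipschitz[where \<phi>="\<lambda>_. 0"]) (auto intro: less_imp_le)
  ultimately show ?thesis unfolding sp_dist_def by (cases "\<mu> w u v") auto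
qed

lemma sp_dist_ge_Lipschitz:
  assumes "\<And>u v. (u, v) \<in> parcs G \<Longrightarrow> \<phi> v - \<phi> u \<le> w (u, v)" "u \<in> pverts G" "v \<in> pverts G"
  shows "\<phi> v - \<phi> u \<le> sp_dist w G u v"
proof -
  have "ereal (\<phi> v - \<phi> u) \<le> \<mu> w u v"
    using assms(1) by (intro \<mu>_ge_Lipschitz) auto
  then show ?thesis using \<mu>_real[OF assms(2,3)] by simp
qed

lemma sp_dist_adjacent:
  assumes "(u, v) \<in> parcs G"
  shows "sp_dist w G u v \<le> w (u, v)"
proof -
  have "\<mu> w u v \<le> awalk_cost w [(u, v)]"
    using arc_implies_awalk[of "(u, v)"] assms by (intro min_cost_le_walk_cost) simp
  then show ?thesis using \<mu>_real[of u v] assms in_arcsD1 in_arcsD2 by simp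
qed

end

section \<open>The graph of nested doubled squares\<close>

lemma mod_pred_eq:
  fixes x H :: int
  assumes "0 < H" "H dvd x + 1"
  shows "x mod H = H - 1"
proof -
  obtain k where k: "x + 1 = H * k" using assms(2) by auto
  then have "x = (H - 1) + H * (k - 1)" by (simp add: algebra_simps)
  then have "x mod H = (H - 1) mod H" using mod_mult_self2[of "H - 1" H "k - 1"] by presburger
  then show ?thesis using mod_pos_pos_trivial[of "H - 1" H] assms(1) by linarith
qed

lemma div_mod_succ_eq:
  fixes x H :: int
  assumes "0 < H" "\<not> H dvd x + 1"
  shows "(x + 1) div H = x div H" and "(x + 1) mod H = x mod H + 1"
proof -
  have r: "x mod H < H" "0 \<le> x mod H" using assms by auto
  have "x mod H \<noteq> H - 1"
  proof
    assume "x mod H = H - 1"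
    then have "x + 1 = H * (x div H) + H" using mult_div_mod_eq[of H x] by linarith
    then show False using assms(2) by (metis dvd_add_triv_right_iff dvd_triv_left)
  qed
  moreover have "x + 1 = H * (x div H) + (x mod H + 1)"
    using mult_div_mod_eq[of H x] by linarith
  ultimately show "(x + 1) div H = x div H" "(x + 1) mod H = x mod H + 1"
    using r int_div_pos_eq[of "x + 1" H "x div H" "x mod H + 1"]
      int_mod_pos_eq[of "x + 1" H "x div H" "x mod H + 1"] by linarith+
qed

text \<open>The distance from \<open>x\<close> to the nearest multiple of \<open>H\<close>.\<close>

definition line_dist :: "int \<Rightarrow> int \<Rightarrow> int" where
  "line_dist H x = min (x mod H) (H - x mod H)"

lemma line_dist_eq_0_iff: "0 < H \<Longrightarrow> line_dist H x = 0 \<longleftrightarrow> H dvd x"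
  unfolding line_dist_def dvd_eq_mod_eq_0
  using pos_mod_bound[of H x] pos_mod_sign[of H x] by linarith

lemma line_dist_nonneg: "0 < H \<Longrightarrow> 0 \<le> line_dist H x"
  unfolding line_dist_def using pos_mod_bound[of H x] pos_mod_sign[of H x] by linarith

lemma line_dist_minus: "0 < H \<Longrightarrow> line_dist H (- x) = line_dist H x"
  by (auto simp: line_dist_def zmod_zminus1_eq_if)

lemma line_dist_cong: "x mod H = y mod H \<Longrightarrow> line_dist H x = line_dist H y"
  by (simp add: line_dist_def)

lemma line_dist_succ:
  assumes "0 < H"
  shows "\<bar>line_dist H (x + 1) - line_dist H x\<bar> \<le> 1"
proof (cases "H dvd x + 1")
  case True
  then have "x mod H = H - 1" using mod_pred_eq assms by blast
  then show ?thesis using True assms by (auto simp: line_dist_def)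
next
  case False
  then have "(x + 1) mod H = x mod H + 1" using div_mod_succ_eq[OF assms] by blast
  then show ?thesis by (auto simp: line_dist_def)
qed

locale nested_squares =
  fixes n :: int and M :: nat
  assumes n_pos: "0 < n"
begin

definition side :: "nat \<Rightarrow> int" where "side i = n * 2 ^ i"

abbreviation N :: int where "N \<equiv> side M"

lemma side_pos: "0 < side i"
  using n_pos by (simp add: side_def)

lemma side_dvd_side: "i \<le> j \<Longrightarrow> side i dvd side j"
  by (simp add: side_def le_imp_power_dvd)

lemma side_Suc: "side (Suc i) = 2 * side i"
  by (simp add: side_def)

definition inner :: "nat \<Rightarrow> int \<Rightarrow> int \<Rightarrow> bool" where
  "inner i x y \<longleftrightarrow> \<not> side i dvd x \<and> \<not> side i dvd y"

text \<open>
  A point of the big square together with, for each level below \<open>M\<close>, the sheet it lies on.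
  Sheets are glued along the grid lines of their level, where the sheet is \<open>False\<close> by convention.
\<close>

fun is_point :: "int \<times> int \<times> bool list \<Rightarrow> bool" where
  "is_point (x, y, b) \<longleftrightarrow> x \<in> {0..N} \<and> y \<in> {0..N} \<and> length b = M \<and> (\<forall>i<M. b ! i \<longrightarrow> inner i x y)"

text \<open>A step with an end on a line of level \<open>i\<close> leaves the sheet of that level
  free, since the two copies are glued there.\<close>

fun near :: "int \<times> int \<times> bool list \<Rightarrow> int \<times> int \<times> bool list \<Rightarrow> bool" where
  "near (x, y, b) (x', y', b') \<longleftrightarrow> \<bar>x - x'\<bar> + \<bar>y - y'\<bar> = 1 \<and>
    (\<forall>i<M. inner i x y \<longrightarrow> inner i x' y' \<longrightarrow> b ! i = b' ! i)"

declare is_point.simps [simp del] near.simps [simp del]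

definition graph :: "nat pair_pre_digraph" where
  "graph = \<lparr>pverts = to_nat ` Collect is_point,
    parcs = {(u, v). \<exists>p q. u = to_nat p \<and> v = to_nat q \<and> is_point p \<and> is_point q \<and> near p q}\<rparr>"

lemma pverts_graph: "pverts graph = to_nat ` Collect is_point"
  by (simp add: graph_def)

lemma parcs_graph:
  "(to_nat p, to_nat q) \<in> parcs graph \<longleftrightarrow> is_point p \<and> is_point q \<and> near p q"
  by (cases p; cases q) (auto simp: graph_def)

lemma parcs_graphE:
  assumes "(u, v) \<in> parcs graph"
  obtains p q where "u = to_nat p" "v = to_nat q" "is_point p" "is_point q" "near p q"
  using assms by (auto simp: graph_def)

lemma near_sym: "near p q \<longleftrightarrow> near q p"
  by (cases p; cases q) (auto simp: near.simps)

lemma finite_points: "finite (Collect is_point)"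
proof (rule finite_subset)
  show "Collect is_point \<subseteq> {0..N} \<times> {0..N} \<times> {b. set b \<subseteq> UNIV \<and> length b = M}"
    by (auto simp: is_point.simps)
  show "finite ({0..N} \<times> {0..N} \<times> {b :: bool list. set b \<subseteq> UNIV \<and> length b = M})"
    by (intro finite_cartesian_product finite_lists_length_eq) auto
qed

sublocale pair_graph graph
proof
  show fin: "finite (pverts graph)" using finite_points by (simp add: pverts_graph)
  show wf: "fst e \<in> pverts graph" "snd e \<in> pverts graph" if "e \<in> parcs graph" for e
    using that by (auto simp: graph_def)
  have "parcs graph \<subseteq> pverts graph \<times> pverts graph" using wf by auto
  then show "finite (parcs graph)" using fin by (meson finite_SigmaI finite_subset)
  show "symmetric (with_proj graph)"
    by (auto simp: symmetric_def graph_def near_sym intro!: symI)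
  show "fst e \<noteq> snd e" if "e \<in> parcs graph" for e
    using that by (auto simp: graph_def near.simps)
qed

section \<open>Folding the plane onto the big square\<close>

text \<open>The distance to the nearest multiple of \<open>2 * N\<close>: the line is reflected onto
  \<open>{0..N}\<close> with period \<open>2 * N\<close>. Averages over positions thus become sums
  over a torus, without boundary terms.\<close>

definition fold_line :: "int \<Rightarrow> int" where
  "fold_line x = \<bar>(x + N) mod (2 * N) - N\<bar>"

lemma fold_line_range: "fold_line x \<in> {0..N}"
  using pos_mod_bound[of "2 * N" "x + N"] pos_mod_sign[of "2 * N" "x + N"] side_pos[of M]
  unfolding fold_line_def atLeastAtMost_iff by linarith

lemma fold_line_id:
  assumes x: "x \<in> {0..N}"
  shows "fold_line x = x"
proof (cases "x = N")
  case True
  then have "(x + N) mod (2 * N) = 0" by (simp flip: mult_2)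
  then show ?thesis unfolding fold_line_def using True side_pos[of M] by linarith
next
  case False
  then have "0 \<le> x + N" "x + N < 2 * N" using x side_pos[of M] by auto
  then have "(x + N) mod (2 * N) = x + N" by (rule mod_pos_pos_trivial)
  then show ?thesis unfolding fold_line_def using x by simp
qed

lemma fold_line_period: "fold_line (x + 2 * N) = fold_line x"
proof -
  have "x + 2 * N + N = x + N + 2 * N" by simp
  then show ?thesis unfolding fold_line_def by (simp only: mod_add_self2)
qed

lemma fold_line_succ: "\<bar>fold_line x - fold_line (x + 1)\<bar> = 1"
proof (cases "2 * N dvd x + N + 1")
  case True
  then have "(x + N) mod (2 * N) = 2 * N - 1"
    using side_pos[of M] by (intro mod_pred_eq) auto
  moreover have "(x + 1 + N) mod (2 * N) = 0" using True by (simp add: algebra_simps dvd_imp_mod_0)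
  ultimately show ?thesis using side_pos[of M] by (simp add: fold_line_def)
next
  case False
  have "(x + N + 1) mod (2 * N) = (x + N) mod (2 * N) + 1"
    using side_pos[of M] False by (intro div_mod_succ_eq) auto
  moreover have "x + 1 + N = x + N + 1" by simp
  ultimately have "fold_line (x + 1) = \<bar>(x + N) mod (2 * N) + 1 - N\<bar>"
    unfolding fold_line_def by (simp only:)
  then show ?thesis unfolding fold_line_def by (simp add: abs_if)
qed

text \<open>The folding is \<open>x\<close> or \<open>- x\<close> up to a multiple of
  \<open>2 * N\<close>, hence of \<open>side i\<close>; so it keeps distances to the grid lines of
  level \<open>i\<close>.\<close>

lemma fold_line_cong:
  assumes "i \<le> M"
  shows "fold_line x mod side i = x mod side i \<or> fold_line x mod side i = (- x) mod side i"
proof -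
  have dvd: "side i dvd 2 * N" "side i dvd N" using side_dvd_side[OF assms] by auto
  define r where "r = (x + N) mod (2 * N) - N"
  have "r = x - 2 * N * ((x + N) div (2 * N))" by (simp add: r_def minus_mult_div_eq_mod[symmetric])
  then have "side i dvd r - x" using dvd(1) by (simp add: dvd_mult2)
  then have "r mod side i = x mod side i" by (simp add: mod_eq_dvd_iff)
  then have "r mod side i = x mod side i" "(- r) mod side i = (- x) mod side i"
    by (auto intro: mod_minus_cong)
  then show ?thesis unfolding fold_line_def r_def[symmetric] abs_if by auto
qed

lemma line_dist_fold_line: "i \<le> M \<Longrightarrow> line_dist (side i) (fold_line x) = line_dist (side i) x"
  using fold_line_cong[of i x] line_dist_cong line_dist_minus side_pos by metis

lemma dvd_fold_line: "i \<le> M \<Longrightarrow> side i dvd fold_line x \<longleftrightarrow> side i dvd x"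
  using line_dist_fold_line line_dist_eq_0_iff side_pos by metis

section \<open>Copies of the plane and connectedness\<close>

definition parity :: "nat \<Rightarrow> int \<Rightarrow> int \<Rightarrow> nat \<times> bool \<times> bool" where
  "parity i x y = (i, odd (x div side i), odd (y div side i))"

text \<open>
  The set \<open>A\<close> selects a sheet for each square of the plane. The selection only depends on the parity
  of the square, which suffices to change the sheet of a square but not those of its neighbours.
\<close>

definition lift :: "int \<Rightarrow> int \<Rightarrow> (nat \<times> bool \<times> bool) set \<Rightarrow> int \<times> int \<times> bool list" where
  "lift x y A = (fold_line x, fold_line y, map (\<lambda>i. inner i x y \<and> parity i x y \<in> A) [0..<M])"

lemma inner_fold_line: "i \<le> M \<Longrightarrow> inner i (fold_line x) (fold_line y) \<longleftrightarrow> inner i x y"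
  by (simp add: inner_def dvd_fold_line)

lemma is_point_lift: "is_point (lift x y A)"
  using fold_line_range[of x] fold_line_range[of y] by (auto simp: lift_def inner_fold_line is_point.simps)

text \<open>If both ends are off the lines of level \<open>i\<close>, they lie in the same square of
  that level, so they have the same parity and get the same sheet.\<close>

lemma near_lift_x: "near (lift x y A) (lift (x + 1) y A)"
  using fold_line_succ[of x] div_mod_succ_eq(1)[OF side_pos]
  by (auto simp: lift_def inner_fold_line parity_def near.simps) (auto simp: inner_def)

lemma near_lift_y: "near (lift x y A) (lift x (y + 1) A)"
  using fold_line_succ[of y] div_mod_succ_eq(1)[OF side_pos]
  by (auto simp: lift_def inner_fold_line parity_def near.simps) (auto simp: inner_def)

lemma lift_cong:
  assumes "\<And>i. i < M \<Longrightarrow> inner i x y \<Longrightarrow> parity i x y \<in> A \<longleftrightarrow> parity i x y \<in> B"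
  shows "lift x y A = lift x y B"
  using assms by (auto simp: lift_def)

lemma side_dvd_period: "i < M \<Longrightarrow> \<exists>k. 2 * N = 2 * k * side i"
  using side_dvd_side[of i M] by (auto simp: dvd_def mult_ac)

lemma lift_period_x: "lift (x + 2 * N) y A = lift x y A"
proof -
  have "inner i (x + 2 * N) y \<longleftrightarrow> inner i x y" "parity i (x + 2 * N) y = parity i x y" if "i < M" for i
  proof -
    obtain k where k: "2 * N = 2 * k * side i" using side_dvd_period[OF \<open>i < M\<close>] by blast
    show "inner i (x + 2 * N) y \<longleftrightarrow> inner i x y"
      unfolding k inner_def by (simp add: dvd_add_left_iff)
    show "parity i (x + 2 * N) y = parity i x y"
      unfolding k parity_def using side_pos[of i] by simp
  qed
  then show ?thesis by (auto simp: lift_def fold_line_period)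
qed

lemma lift_period_y: "lift x (y + 2 * N) A = lift x y A"
proof -
  have "inner i x (y + 2 * N) \<longleftrightarrow> inner i x y" "parity i x (y + 2 * N) = parity i x y" if "i < M" for i
  proof -
    obtain k where k: "2 * N = 2 * k * side i" using side_dvd_period[OF \<open>i < M\<close>] by blast
    show "inner i x (y + 2 * N) \<longleftrightarrow> inner i x y"
      unfolding k inner_def by (simp add: dvd_add_left_iff)
    show "parity i x (y + 2 * N) = parity i x y"
      unfolding k parity_def using side_pos[of i] by simp
  qed
  then show ?thesis by (auto simp: lift_def fold_line_period)
qed

lemma point_eq_lift:
  assumes "is_point (x, y, b)"
  shows "(x, y, b) = lift x y {(i, p, q). b ! i}"
  using assms by (auto simp: lift_def fold_line_id parity_def is_point.simps intro!: nth_equalityI)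

text \<open>Walk straight to \<open>x = 0\<close> and then to \<open>y = 0\<close> inside one copy
  of the plane through \<open>p\<close>. At the corner all levels are glued, so the end does not
  depend on the sheets of \<open>p\<close>.\<close>

lemma reachable_origin:
  assumes "is_point p"
  shows "to_nat p \<rightarrow>\<^sup>*\<^bsub>with_proj graph\<^esub> to_nat (0::int, 0::int, replicate M False)"
proof -
  obtain x y b where p: "p = (x, y, b)" by (cases p)
  define A :: "(nat \<times> bool \<times> bool) set" where "A = {(i, p, q). b ! i}"
  have xy: "x \<in> {0..N}" "y \<in> {0..N}" using assms p by (auto simp: is_point.simps)
  have arcx: "(to_nat (lift (a + 1) c A), to_nat (lift a c A)) \<in> parcs graph" for a c
    using near_lift_x near_sym is_point_lift by (auto simp: parcs_graph)
  have arcy: "(to_nat (lift a (c + 1) A), to_nat (lift a c A)) \<in> parcs graph" for a c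
    using near_lift_y near_sym is_point_lift by (auto simp: parcs_graph)
  have "to_nat (lift (int k) c A) \<rightarrow>\<^sup>*\<^bsub>with_proj graph\<^esub> to_nat (lift 0 c A)" for k c
  proof (induct k)
    case 0
    then show ?case using is_point_lift by (auto simp: pverts_graph)
  next
    case (Suc k)
    then show ?case using adj_reachable_trans arcx[of "int k" c] by (simp add: add.commute)
  qed
  from this[of "nat x" y] have 1: "to_nat p \<rightarrow>\<^sup>*\<^bsub>with_proj graph\<^esub> to_nat (lift 0 y A)"
    using point_eq_lift assms xy unfolding p A_def by auto
  have "to_nat (lift 0 (int k) A) \<rightarrow>\<^sup>*\<^bsub>with_proj graph\<^esub> to_nat (lift 0 0 A)" for k
  proof (induct k)
    case 0
    then show ?case using is_point_lift by (auto simp: pverts_graph)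
  next
    case (Suc k)
    then show ?case using adj_reachable_trans arcy[of 0 "int k"] by (simp add: add.commute)
  qed
  from this[of "nat y"] 1 have "to_nat p \<rightarrow>\<^sup>*\<^bsub>with_proj graph\<^esub> to_nat (lift 0 0 A)"
    using xy reachable_trans by simp
  moreover have "lift 0 0 A = (0, 0, replicate M False)"
    using fold_line_id[of 0] side_pos[of M]
    by (auto simp: lift_def inner_def intro!: nth_equalityI)
  ultimately show ?thesis by simp
qed

sublocale weighted_graph graph "\<lambda>_. 1"
proof
  have "u \<rightarrow>\<^sup>*\<^bsub>with_proj graph\<^esub> v" if "u \<in> pverts graph" "v \<in> pverts graph" for u v
    using that reachable_origin symmetric_reachable' reachable_trans
    unfolding pverts_graph by (metis (no_types, lifting) imageE mem_Collect_eq)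
  moreover have "pverts graph \<noteq> {}"
    using is_point_lift[of 0 0 "{}"] unfolding pverts_graph by blast
  ultimately show "connected (with_proj graph)"
    unfolding connected_def strongly_connected_def
    using reachable_mk_symmetric_eq[OF pair_sym_arcs] by simp
qed auto

text \<open>The signed distance to the lines of level \<open>i\<close> separates the two sheets of a square.\<close>

definition signed_dist :: "nat \<Rightarrow> int \<times> int \<times> bool list \<Rightarrow> int" where
  "signed_dist i p = (case p of (x, y, b) \<Rightarrow>
    (if b ! i then 1 else - 1) * min (line_dist (side i) x) (line_dist (side i) y))"

text \<open>The sheet can change only in a step with an end on the lines of level \<open>i\<close>,
  where the value is 0; in all other steps the sign is constant and the unsigned distance is
  1-Lipschitz.\<close>

lemma signed_dist_near:
  assumes i: "i < M" and "near p q"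
  shows "\<bar>signed_dist i p - signed_dist i q\<bar> \<le> 1"
proof -
  obtain x y b x' y' b' where pq: "p = (x, y, b)" "q = (x', y', b')" by (cases p; cases q)
  define d where "d = min (line_dist (side i) x) (line_dist (side i) y)"
  define d' where "d' = min (line_dist (side i) x') (line_dist (side i) y')"
  have "x' = x \<and> y' = y + 1 \<or> x' = x \<and> y = y' + 1 \<or> y' = y \<and> x' = x + 1 \<or> y' = y \<and> x = x' + 1"
    using assms(2) pq by (auto simp: near.simps)
  then have dd: "\<bar>d - d'\<bar> \<le> 1"
    using line_dist_succ[OF side_pos, of i x] line_dist_succ[OF side_pos, of i x']
      line_dist_succ[OF side_pos, of i y] line_dist_succ[OF side_pos, of i y']
    unfolding d_def d'_def by (elim disjE conjE) (hypsubst, linarith)+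
  have nn: "0 \<le> d" "0 \<le> d'" using line_dist_nonneg[OF side_pos] by (auto simp: d_def d'_def)
  have "d = 0" if "\<not> inner i x y"
    using that nn line_dist_eq_0_iff[OF side_pos] line_dist_nonneg[OF side_pos]
    unfolding inner_def d_def by (metis min.absorb1 min.absorb2)
  moreover have "d' = 0" if "\<not> inner i x' y'"
    using that nn line_dist_eq_0_iff[OF side_pos] line_dist_nonneg[OF side_pos]
    unfolding inner_def d'_def by (metis min.absorb1 min.absorb2)
  moreover have "b ! i = b' ! i" if "inner i x y" "inner i x' y'"
    using that assms pq by (simp add: near.simps)
  ultimately show ?thesis
    using dd nn unfolding signed_dist_def pq prod.case d_def[symmetric] d'_def[symmetric]
    by (cases "inner i x y"; cases "inner i x' y'"; cases "b ! i"; cases "b' ! i") auto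
qed

lemma sheet_dist:
  assumes i: "i < M" and p: "is_point (x, y, b)" "is_point (x, y, b')" and ne: "b ! i \<noteq> b' ! i"
  shows "2 * min (line_dist (side i) x) (line_dist (side i) y)
    \<le> sp_dist (\<lambda>_. 1) graph (to_nat (x, y, b)) (to_nat (x, y, b'))"
proof -
  define \<phi> :: "nat \<Rightarrow> real" where
    "\<phi> v = (if b ! i then - 1 else 1) * real_of_int (signed_dist i (from_nat v))" for v
  have "\<phi> v - \<phi> u \<le> 1" if "(u, v) \<in> parcs graph" for u v
  proof -
    obtain p q where "u = to_nat p" "v = to_nat q" "near p q"
      using \<open>(u, v) \<in> parcs graph\<close> by (rule parcs_graphE)
    then show ?thesis using signed_dist_near[OF i, of p q] by (auto simp: \<phi>_def)
  qed
  then have "\<phi> (to_nat (x, y, b')) - \<phi> (to_nat (x, y, b))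
      \<le> sp_dist (\<lambda>_. 1) graph (to_nat (x, y, b)) (to_nat (x, y, b'))"
    using p by (intro sp_dist_ge_Lipschitz) (auto simp: pverts_graph)
  then show ?thesis using ne by (auto simp: \<phi>_def signed_dist_def split: if_splits)
qed

end

section \<open>Shortest path decomposition of the nested squares\<close>

context nested_squares
begin

text \<open>Rows and columns are treated alike: \<open>s\<close> tells whether the two coordinates are swapped.\<close>

fun along :: "bool \<Rightarrow> int \<times> int \<times> bool list \<Rightarrow> int" where
  "along s (x, y, b) = (if s then y else x)"

fun across :: "bool \<Rightarrow> int \<times> int \<times> bool list \<Rightarrow> int" where
  "across s (x, y, b) = (if s then x else y)"

fun sheets :: "int \<times> int \<times> bool list \<Rightarrow> bool list" where
  "sheets (x, y, b) = b"

definition point :: "bool \<Rightarrow> int \<Rightarrow> int \<Rightarrow> bool list \<Rightarrow> int \<times> int \<times> bool list" where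
  "point s u v b = (if s then (v, u, b) else (u, v, b))"

lemma point_sel [simp]: "along s (point s u v b) = u" "across s (point s u v b) = v"
  "sheets (point s u v b) = b"
  by (auto simp: point_def)

lemma point_collapse: "point s (along s p) (across s p) (sheets p) = p"
  by (cases p) (auto simp: point_def)

lemma is_point_point: "is_point (point s u v b) \<longleftrightarrow> u \<in> {0..N} \<and> v \<in> {0..N} \<and> length b = M \<and>
    (\<forall>j<M. b ! j \<longrightarrow> \<not> side j dvd u \<and> \<not> side j dvd v)"
  by (auto simp: point_def is_point.simps inner_def)

lemma near_point: "near (point s u v b) (point s u' v' b') \<longleftrightarrow> \<bar>u - u'\<bar> + \<bar>v - v'\<bar> = 1 \<and>
    (\<forall>j<M. \<not> side j dvd u \<and> \<not> side j dvd v \<longrightarrow> \<not> side j dvd u' \<and> \<not> side j dvd v' \<longrightarrow> b ! j = b' ! j)"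
  by (auto simp: point_def near.simps inner_def)

section \<open>Regions cut out by the coordinates, and deletion of rows\<close>

definition region :: "bool \<Rightarrow> (int \<Rightarrow> bool) \<Rightarrow> (int \<Rightarrow> bool) \<Rightarrow> nat set" where
  "region s P Q = to_nat ` {p. is_point p \<and> P (along s p) \<and> Q (across s p)}"

lemma region_swap: "region (\<not> s) P Q = region s Q P"
proof -
  have "along (\<not> s) p = across s p" "across (\<not> s) p = along s p" for p
    by (cases p; auto)+
  then show ?thesis by (auto simp: region_def)
qed

lemma in_region: "to_nat p \<in> region s P Q \<longleftrightarrow> is_point p \<and> P (along s p) \<and> Q (across s p)"
  by (auto simp: region_def)

lemma regionE:
  assumes "v \<in> region s P Q"
  obtains u w b where "v = to_nat (point s u w b)" "is_point (point s u w b)" "P u" "Q w"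
proof -
  obtain p where "v = to_nat p" "is_point p" "P (along s p)" "Q (across s p)"
    using assms unfolding region_def by blast
  then show ?thesis
    using that[of "along s p" "across s p" "sheets p"] by (simp add: point_collapse)
qed

abbreviation SPD_le :: "nat \<Rightarrow> nat set \<Rightarrow> bool" where
  "SPD_le \<equiv> comps_SPD_le (\<lambda>_. 1) (with_proj graph)"

text \<open>
  Deletes the rows selected by \<open>R\<close>. Vertices on them must lie on the lines of all levels below \<open>a\<close>,
  so that they have only one copy in each component, and components must avoid the lines of all
  other levels.
\<close>

lemma SPD_le_delete_rows:
  fixes lu lv :: "int \<Rightarrow> int"
  assumes k: "1 \<le> k" and rest: "SPD_le k (region s P (\<lambda>v. Q v \<and> \<not> R v))"
    and lu: "\<And>u. P u \<Longrightarrow> P (u + 1) \<Longrightarrow> lu (u + 1) = lu u"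
    and convex: "\<And>u1 u u2. \<lbrakk>0 \<le> u1; u1 \<le> u; u \<le> u2; u2 \<le> N; P u1; P u2; lu u1 = lu u2\<rbrakk> \<Longrightarrow> P u \<and> lu u = lu u1"
    and lv: "\<And>v. Q v \<Longrightarrow> Q (v + 1) \<Longrightarrow> lv (v + 1) = lv v"
    and unique: "\<And>v v'. \<lbrakk>Q v; R v; Q v'; R v'; lv v = lv v'\<rbrakk> \<Longrightarrow> v = v'"
    and below: "\<And>j v. \<lbrakk>j < a; j < M; Q v; R v\<rbrakk> \<Longrightarrow> side j dvd v"
    and above: "\<And>j u. \<lbrakk>a \<le> j; j < M; P u\<rbrakk> \<Longrightarrow> \<not> side j dvd u"
      "\<And>j v. \<lbrakk>a \<le> j; j < M; Q v\<rbrakk> \<Longrightarrow> \<not> side j dvd v"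
  shows "SPD_le (k + 1) (region s P Q)"
proof -
  let ?S = "region s P Q" and ?D = "region s P (\<lambda>v. Q v \<and> R v)"
  \<comment> \<open>The label records the blocks of both coordinates and the sheets of levels from
    \<open>a\<close> on; lower sheets may vary inside a component.\<close>
  define c where "c i = (let p = from_nat i in (lu (along s p), lv (across s p), drop a (sheets p)))" for i
  define \<xi> where "\<xi> i = along s (from_nat i)" for i
  have D: "i \<in> ?D \<Longrightarrow> i \<in> ?S" for i by (auto simp: region_def)
  show ?thesis
  proof (rule comps_SPD_le_step[where D="?D" and c=c and \<xi>=\<xi>])
    show "?S \<subseteq> pverts graph" by (auto simp: region_def pverts_graph)
    have "?S - ?D = region s P (\<lambda>v. Q v \<and> \<not> R v)"
    proof (intro set_eqI iffI)
      fix i assume i: "i \<in> ?S - ?D"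
      then have "i \<in> ?S" by simp
      then obtain u w b where "i = to_nat (point s u w b)" "is_point (point s u w b)" "P u" "Q w"
        by (rule regionE)
      then show "i \<in> region s P (\<lambda>v. Q v \<and> \<not> R v)" using i by (simp add: in_region)
    next
      fix i assume "i \<in> region s P (\<lambda>v. Q v \<and> \<not> R v)"
      then obtain u w b where "i = to_nat (point s u w b)" "is_point (point s u w b)" "P u" "Q w \<and> \<not> R w"
        by (rule regionE)
      then show "i \<in> ?S - ?D" by (simp add: in_region)
    qed
    then show "SPD_le k (?S - ?D)" using rest by simp
    show "c i = c j" if ij: "(i, j) \<in> parcs graph" "i \<in> ?S" "j \<in> ?S" for i j
    proof -
      obtain u w b where i: "i = to_nat (point s u w b)" "is_point (point s u w b)" "P u" "Q w"
        using ij(2) by (rule regionE)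
      obtain u' w' b' where j: "j = to_nat (point s u' w' b')" "is_point (point s u' w' b')" "P u'" "Q w'"
        using ij(3) by (rule regionE)
      have near: "near (point s u w b) (point s u' w' b')" using ij(1) i j by (simp add: parcs_graph)
      have "u' = u \<and> w' = w + 1 \<or> u' = u \<and> w = w' + 1 \<or> w' = w \<and> u' = u + 1 \<or> w' = w \<and> u = u' + 1"
        using near unfolding near_point by auto
      then have "lu u = lu u'" "lv w = lv w'" using lu lv i j by metis+
      moreover have "drop a b = drop a b'"
        using near i j above unfolding near_point is_point_point
        by (intro nth_equalityI) (auto simp: near_point)
      ultimately show ?thesis by (simp add: c_def i j Let_def)
    qed
    show "\<xi> j - \<xi> i \<le> 1" if "(i, j) \<in> parcs graph" for i j
    proof -
      obtain p q where pq: "i = to_nat p" "j = to_nat q" "near p q" using \<open>(i, j) \<in> parcs graph\<close> by (rule parcs_graphE)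
      then have "near (point s (along s p) (across s p) (sheets p)) (point s (along s q) (across s q) (sheets q))"
        by (simp add: point_collapse)
      then have "\<bar>along s p - along s q\<bar> + \<bar>across s p - across s q\<bar> = 1"
        unfolding near_point by blast
      then show ?thesis by (simp add: \<xi>_def pq)
    qed
    fix d assume d: "d \<in> ?D \<inter> ?S"
    then have "d \<in> ?D" by simp
    then obtain u0 w b where d: "d = to_nat (point s u0 w b)" "is_point (point s u0 w b)" "P u0" "Q w \<and> R w"
      by (rule regionE)
    note dp = d(2)[unfolded is_point_point]
    \<comment> \<open>The positions along the row in the block of \<open>u0\<close>; by
      \<open>convex\<close> they form an interval, which yields the segment.\<close>
    define I where "I = {u \<in> {0..N}. P u \<and> lu u = lu u0}"
    have "finite I" unfolding I_def by (rule finite_subset[of _ "{0..N}"]) auto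
    moreover have "u0 \<in> I" using d dp by (simp add: I_def)
    ultimately have I: "finite I" "u0 \<in> I" by auto
    define lo where "lo = Min I"
    define hi where "hi = Max I"
    have lohi: "lo \<in> I" "hi \<in> I" "lo \<le> hi"
      unfolding lo_def hi_def
      using I Min_in[of I] Max_in[of I] order_trans[OF Min_le[of I u0] Max_ge[of I u0]] by blast+
    have I_eq: "I = {lo..hi}"
    proof
      show "I \<subseteq> {lo..hi}" using I by (auto simp: lo_def hi_def)
      show "{lo..hi} \<subseteq> I"
      proof
        fix u assume u: "u \<in> {lo..hi}"
        have "P u \<and> lu u = lu lo" using lohi u by (intro convex[of lo u hi]) (auto simp: I_def)
        then show "u \<in> I" using lohi u by (auto simp: I_def)
      qed
    qed
    define g where "g t = to_nat (point s (lo + int t) w b)" for t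
    \<comment> \<open>The row lies on the lines of all levels below \<open>a\<close>, so only sheets
      from \<open>a\<close> on can be \<open>True\<close> there, and no line of those levels is met
      along the row.\<close>
    have bits: "b ! j \<Longrightarrow> j < M \<Longrightarrow> a \<le> j" for j
      using dp below[of j w] d(4) by (meson not_le)
    have pt: "is_point (point s u w b)" if "u \<in> I" for u
      using that dp bits above(1)[of _ u] unfolding is_point_point I_def by auto
    have component: "{v \<in> ?D \<inter> ?S. c v = c d} = g ` {..nat (hi - lo)}"
    proof (intro set_eqI iffI)
      fix i assume i: "i \<in> {v \<in> ?D \<inter> ?S. c v = c d}"
      then have "i \<in> ?D" by simp
      then obtain u' w' b' where i': "i = to_nat (point s u' w' b')" "is_point (point s u' w' b')"
        "P u'" "Q w' \<and> R w'"
        by (rule regionE)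
      note ip = i'(2)[unfolded is_point_point]
      have c: "lu u' = lu u0" "lv w' = lv w" "drop a b' = drop a b"
        using i by (auto simp: c_def i' d)
      then have w: "w' = w" using unique i' d by blast
      have "b' = b"
      proof (rule nth_equalityI)
        show "length b' = length b" using ip dp by simp
        fix j assume j: "j < length b'"
        show "b' ! j = b ! j"
        proof (cases "j < a")
          case True
          then show ?thesis using below[of j w] i' d(4) j ip dp w by auto
        next
          case False
          then show ?thesis using c(3) j ip dp nth_drop[of a b' "j - a"] nth_drop[of a b "j - a"] by auto
        qed
      qed
      moreover have "u' \<in> I" using i' ip c by (auto simp: I_def)
      ultimately show "i \<in> g ` {..nat (hi - lo)}"
        using w i'(1) unfolding I_eq g_def by (intro image_eqI[of _ _ "nat (u' - lo)"]) auto
    next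
      fix i assume "i \<in> g ` {..nat (hi - lo)}"
      then obtain t where t: "i = g t" "lo + int t \<in> I" using lohi unfolding I_eq by auto
      then show "i \<in> {v \<in> ?D \<inter> ?S. c v = c d}"
        using pt[OF t(2)] d by (auto simp: in_region g_def I_def c_def)
    qed
    show "\<exists>g m. {v \<in> ?D \<inter> ?S. c v = c d} = g ` {..m::nat} \<and>
      (\<forall>t<m. (g t, g (Suc t)) \<in> parcs graph) \<and> (\<forall>t\<le>m. \<xi> (g t) = \<xi> (g 0) + int t)"
    proof (intro exI conjI allI impI)
      show "{v \<in> ?D \<inter> ?S. c v = c d} = g ` {..nat (hi - lo)}" by (rule component)
      fix t assume "t < nat (hi - lo)"
      then have "lo + int t \<in> I" "lo + int (Suc t) \<in> I" unfolding I_eq by auto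
      then show "(g t, g (Suc t)) \<in> parcs graph"
        unfolding g_def parcs_graph by (auto simp: pt near_point simp del: of_nat_Suc)
    next
      show "\<xi> (g t) = \<xi> (g 0) + int t" for t by (simp add: g_def \<xi>_def)
    qed
  qed (rule k)
qed

section \<open>Deletion of the bottom level, the midlines and the boundary\<close>

lemma div_between:
  fixes H :: int
  assumes "0 < H" "\<not> H dvd u1" "\<not> H dvd u2" "u1 \<le> u" "u \<le> u2" "u1 div H = u2 div H"
  shows "\<not> H dvd u \<and> u div H = u1 div H"
proof -
  have "u1 div H \<le> u div H" "u div H \<le> u2 div H" using assms zdiv_mono1[of u1 u H] zdiv_mono1[of u u2 H] by auto
  then have e: "u div H = u1 div H" using assms by simp
  moreover have "\<not> H dvd u"
  proof
    assume "H dvd u"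
    then have "u = H * (u1 div H)" using e by (metis dvd_mult_div_cancel)
    then have "u1 mod H \<le> 0" using assms mult_div_mod_eq[of H u1] by linarith
    then show False
      using assms(1,2) pos_mod_sign[of H u1] unfolding dvd_eq_mod_eq_0 by linarith
  qed
  ultimately show ?thesis by simp
qed

text \<open>Both are odd multiples of \<open>H\<close>, and a block of length \<open>2 * H\<close>
  contains only one.\<close>

lemma midline_unique:
  fixes H :: int
  assumes "0 < H" "H dvd v" "H dvd v'" "\<not> 2 * H dvd v" "\<not> 2 * H dvd v'" "v div (2 * H) = v' div (2 * H)"
  shows "v = v'"
proof -
  obtain k k' where k: "v = H * k" "v' = H * k'" using assms by (auto simp: dvd_def)
  have "odd k" "odd k'" using assms unfolding k by (auto simp: mult.commute[of 2 H])
  moreover have "k div 2 = k' div 2"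
    using assms unfolding k by (simp add: mult.commute[of 2 H])
  ultimately have "k = k'" by presburger
  then show ?thesis using k by simp
qed

text \<open>The interior rows of the squares of level 0 are deleted by residue modulo
  \<open>n\<close>, in all squares and copies simultaneously. No grid line is left in the region, so
  \<open>a = 0\<close> and the label keeps all sheets.\<close>

lemma SPD_le_bottom: "SPD_le (nat n) (region False (\<lambda>u. \<not> side 0 dvd u) (\<lambda>v. \<not> side 0 dvd v))"
proof -
  have "SPD_le (Suc r) (region False (\<lambda>u. \<not> side 0 dvd u) (\<lambda>v. n - 1 - int r < v mod n))"
    if "int r < n" for r
    using that
  proof (induct r)
    case 0
    \<comment> \<open>No row remains for \<open>r = 0\<close>, yet the depth starts at 1, the least
      value on which \<open>has_SPD.step\<close> can build.\<close>
    have "\<not> n - 1 < v mod n" for v using pos_mod_bound[OF n_pos, of v] by linarith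
    then have "region False (\<lambda>u. \<not> side 0 dvd u) (\<lambda>v. n - 1 - int 0 < v mod n) = {}"
      by (auto simp: region_def)
    then show ?case by (metis comps_SPD_le_empty)
  next
    case (Suc r)
    let ?Q = "\<lambda>v. n - 1 - int (Suc r) < v mod n"
    have nd: "\<not> side j dvd v" if "?Q v" for j v
    proof
      assume "side j dvd v"
      then have "n dvd v" by (auto simp: side_def intro: dvd_mult_left)
      then show False using that Suc(2) by auto
    qed
    have "SPD_le (Suc r + 1) (region False (\<lambda>u. \<not> side 0 dvd u) ?Q)"
    proof (rule SPD_le_delete_rows[where R="\<lambda>v. v mod n = n - 1 - int r" and a=0
          and lu="\<lambda>u. u div side 0" and lv="\<lambda>v. v div n"])
      have "(\<lambda>v. ?Q v \<and> v mod n \<noteq> n - 1 - int r) = (\<lambda>v. n - 1 - int r < v mod n)" by auto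
      then show "SPD_le (Suc r) (region False (\<lambda>u. \<not> side 0 dvd u) (\<lambda>v. ?Q v \<and> v mod n \<noteq> n - 1 - int r))"
        using Suc by simp
      show "(u + 1) div side 0 = u div side 0" if "\<not> side 0 dvd u + 1" for u
        using div_mod_succ_eq(1)[OF side_pos that] .
      show "\<not> side 0 dvd u \<and> u div side 0 = u1 div side 0"
        if "u1 \<le> u" "u \<le> u2" "\<not> side 0 dvd u1" "\<not> side 0 dvd u2" "u1 div side 0 = u2 div side 0" for u1 u u2
        using that side_pos by (intro div_between) auto
      show "(v + 1) div n = v div n" if "?Q (v + 1)" for v
        using nd[OF that, of 0] by (intro div_mod_succ_eq(1)[OF n_pos]) (simp add: side_def)
      show "v = v'" if "v mod n = n - 1 - int r" "v' mod n = n - 1 - int r" "v div n = v' div n" for v v'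
        using that by (metis mult_div_mod_eq)
      show "\<not> side j dvd u" if "\<not> side 0 dvd u" for j u
        using that side_dvd_side[of 0 j] dvd_trans by blast
    qed (use nd in auto)
    then show ?case by simp
  qed
  from this[of "nat n - 1"] have "SPD_le (nat n) (region False (\<lambda>u. \<not> side 0 dvd u) (\<lambda>v. 0 < v mod n))"
    using n_pos by (simp add: of_nat_diff)
  moreover have "0 < v mod n \<longleftrightarrow> \<not> side 0 dvd v" for v
    using pos_mod_sign[OF n_pos, of v] by (auto simp: side_def dvd_eq_mod_eq_0 less_le)
  ultimately show ?thesis by simp
qed

text \<open>The odd multiples of \<open>side i\<close> are the midlines of the squares of level
  \<open>Suc i\<close>. All levels up to \<open>i\<close> are glued there, hence
  \<open>a = Suc i\<close>. The two forms of \<open>P\<close> cover the other direction being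
  already cut or not.\<close>

lemma SPD_le_midlines:
  assumes k: "1 \<le> k" and "i < M"
    and P: "P = (\<lambda>u. \<not> side i dvd u) \<or> P = (\<lambda>u. \<not> side (Suc i) dvd u)"
    and rest: "SPD_le k (region s P (\<lambda>v. \<not> side i dvd v))"
  shows "SPD_le (k + 1) (region s P (\<lambda>v. \<not> side (Suc i) dvd v))"
proof -
  obtain l where l: "l \<le> Suc i" "P = (\<lambda>u. \<not> side l dvd u)" using P by (metis le_SucI order_refl)
  have nd: "\<not> side j dvd u" if "m \<le> j" "\<not> side m dvd u" for j m u
    using that side_dvd_side[of m j] dvd_trans by blast
  show ?thesis
  proof (rule SPD_le_delete_rows[where R="\<lambda>v. side i dvd v" and a="Suc i"
        and lu="\<lambda>u. u div side l" and lv="\<lambda>v. v div side (Suc i)", OF k])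
    have "(\<lambda>v. \<not> side (Suc i) dvd v \<and> \<not> side i dvd v) = (\<lambda>v. \<not> side i dvd v)"
      using nd[of i "Suc i"] by auto
    then show "SPD_le k (region s P (\<lambda>v. \<not> side (Suc i) dvd v \<and> \<not> side i dvd v))" using rest by simp
    show "(u + 1) div side l = u div side l" if "P (u + 1)" for u
      using div_mod_succ_eq(1)[OF side_pos] that l by auto
    show "P u \<and> u div side l = u1 div side l"
      if "u1 \<le> u" "u \<le> u2" "P u1" "P u2" "u1 div side l = u2 div side l" for u1 u u2
      using that side_pos div_between unfolding l by blast
    show "(v + 1) div side (Suc i) = v div side (Suc i)" if "\<not> side (Suc i) dvd v + 1" for v
      using div_mod_succ_eq(1)[OF side_pos that] .
    show "v = v'" if "side i dvd v" "side i dvd v'" "\<not> side (Suc i) dvd v" "\<not> side (Suc i) dvd v'"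
      "v div side (Suc i) = v' div side (Suc i)" for v v'
      using midline_unique[of "side i" v v'] that side_pos unfolding side_Suc by blast
    show "side j dvd v" if "j < Suc i" "side i dvd v" for j v
      using that side_dvd_side[of j i] dvd_trans by auto
    show "\<not> side j dvd u" if "Suc i \<le> j" "P u" for j u
      using that nd[of l j u] l by auto
    show "\<not> side j dvd v" if "Suc i \<le> j" "\<not> side (Suc i) dvd v" for j v
      using nd that by blast
  qed
qed

text \<open>Two steps per level: first a full midline of each square, then both halves of the other
  one.\<close>

lemma SPD_le_level:
  "i \<le> M \<Longrightarrow> SPD_le (nat n + 2 * i) (region False (\<lambda>u. \<not> side i dvd u) (\<lambda>v. \<not> side i dvd v))"
proof (induct i)
  case 0
  then show ?case using SPD_le_bottom by simp
next
  case (Suc i)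
  have k: "1 \<le> nat n" using n_pos by simp
  have "SPD_le (nat n + 2 * i) (region True (\<lambda>v. \<not> side i dvd v) (\<lambda>u. \<not> side i dvd u))"
    using Suc region_swap[of False "\<lambda>u. \<not> side i dvd u" "\<lambda>u. \<not> side i dvd u"] by simp
  then have "SPD_le (nat n + 2 * i + 1) (region True (\<lambda>v. \<not> side i dvd v) (\<lambda>u. \<not> side (Suc i) dvd u))"
    using Suc k by (intro SPD_le_midlines) auto
  then have "SPD_le (nat n + 2 * i + 1) (region False (\<lambda>u. \<not> side (Suc i) dvd u) (\<lambda>v. \<not> side i dvd v))"
    using region_swap[of False "\<lambda>u. \<not> side i dvd u" "\<lambda>u. \<not> side (Suc i) dvd u"] by simp
  then have "SPD_le (nat n + 2 * i + 1 + 1) (region False (\<lambda>u. \<not> side (Suc i) dvd u) (\<lambda>v. \<not> side (Suc i) dvd v))"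
    using Suc k by (intro SPD_le_midlines) auto
  then show ?case by simp
qed

text \<open>Inside the big square, \<open>N dvd u\<close> means \<open>u = 0\<close> or
  \<open>u = N\<close>. All levels below \<open>M\<close> are glued on these two sides, so each is
  deleted as a single segment, with constant block labels.\<close>

lemma SPD_le_boundary:
  assumes k: "1 \<le> k" and P: "P = (\<lambda>_. True) \<or> P = (\<lambda>u. \<not> N dvd u)"
    and rest: "SPD_le k (region s P (\<lambda>v. \<not> N dvd v))"
  shows "SPD_le (k + 2) (region s P (\<lambda>_. True))"
proof -
  have dvd: "N dvd u \<longleftrightarrow> u = 0 \<or> u = N" if "0 \<le> u" "u \<le> N" for u
    using that side_pos[of M] by (metis dvd_0_right dvd_refl le_less zdvd_not_zless)
  have convex: "P u" if "0 \<le> u1" "u1 \<le> u" "u \<le> u2" "u2 \<le> N" "P u1" "P u2" for u1 u u2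
    using P that dvd[of u1] dvd[of u] dvd[of u2] by auto
  have "region s P (\<lambda>v. \<not> N dvd v) = region s P (\<lambda>v. v \<noteq> 0 \<and> v \<noteq> N)"
  proof (intro set_eqI iffI)
    fix i assume "i \<in> region s P (\<lambda>v. \<not> N dvd v)"
    then obtain u w b where "i = to_nat (point s u w b)" "is_point (point s u w b)" "P u" "\<not> N dvd w"
      by (rule regionE)
    then show "i \<in> region s P (\<lambda>v. v \<noteq> 0 \<and> v \<noteq> N)" by (auto simp: in_region)
  next
    fix i assume "i \<in> region s P (\<lambda>v. v \<noteq> 0 \<and> v \<noteq> N)"
    then obtain u w b where "i = to_nat (point s u w b)" "is_point (point s u w b)" "P u" "w \<noteq> 0 \<and> w \<noteq> N"
      by (rule regionE)
    then show "i \<in> region s P (\<lambda>v. \<not> N dvd v)" using dvd[of w] by (auto simp: in_region is_point_point)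
  qed
  with rest have rest': "SPD_le k (region s P (\<lambda>v. v \<noteq> 0 \<and> v \<noteq> N))" by simp
  have "SPD_le (k + 1) (region s P (\<lambda>v. v \<noteq> 0))"
  proof (rule SPD_le_delete_rows[where R="\<lambda>v. v = N" and a=M and lu="\<lambda>_. 0" and lv="\<lambda>_. 0", OF k rest'])
    show "side j dvd v" if "j < M" "v = N" for j v using side_dvd_side[of j M] that by simp
    show "P u \<and> (0::int) = 0" if "0 \<le> u1" "u1 \<le> u" "u \<le> u2" "u2 \<le> N" "P u1" "P u2" for u1 u u2
      using convex[OF that] by simp
  qed auto
  then have rest'': "SPD_le (k + 1) (region s P (\<lambda>v. True \<and> v \<noteq> 0))" by simp
  have "SPD_le (k + 1 + 1) (region s P (\<lambda>_. True))"
  proof (rule SPD_le_delete_rows[where R="\<lambda>v. v = 0" and a=M and lu="\<lambda>_. 0" and lv="\<lambda>_. 0", OF _ rest''])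
    show "P u \<and> (0::int) = 0" if "0 \<le> u1" "u1 \<le> u" "u \<le> u2" "u2 \<le> N" "P u1" "P u2" for u1 u u2
      using convex[OF that] by simp
  qed auto
  then show ?thesis by simp
qed

text \<open>The depth is \<open>n\<close> for the squares of level 0, two for each of the
  \<open>M\<close> levels and four for the sides of the big square.\<close>

lemma spd_depth_graph: "spd_depth (\<lambda>_. 1) (with_proj graph) \<le> enat (nat n + 2 * M + 4)"
proof -
  let ?k = "nat n + 2 * M"
  have k: "1 \<le> ?k" using n_pos by simp
  have "SPD_le (?k + 2) (region False (\<lambda>u. \<not> N dvd u) (\<lambda>_. True))"
    using SPD_le_level[of M] k by (intro SPD_le_boundary) auto
  then have "SPD_le (?k + 2 + 2) (region True (\<lambda>_. True) (\<lambda>_. True))"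
    using k region_swap[of False "\<lambda>_. True" "\<lambda>u. \<not> N dvd u"] by (intro SPD_le_boundary) auto
  moreover have "region True (\<lambda>_. True) (\<lambda>_. True) = pverts graph"
    by (auto simp: region_def pverts_graph)
  ultimately have "SPD_le (?k + 4) (pverts graph)" by (simp add: numeral_eq_Suc)
  then obtain j where "j \<le> ?k + 4" "has_SPD (\<lambda>_. 1) (with_proj graph) j"
    using comps_SPD_le_imp_has_SPD connected_G by blast
  then show ?thesis unfolding spd_depth_def by (intro INF_lower2[of j]) auto
qed

end

section \<open>Averaging over all scales\<close>

locale embedded_squares = nested_squares +
  fixes f :: "nat \<Rightarrow> nat \<Rightarrow> real" and \<tau> \<rho> :: real
  assumes four_dvd_n: "4 dvd n"
    and \<tau>_ge_1: "1 \<le> \<tau>" and \<rho>_ge_1: "1 \<le> \<rho>"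
    and f_l1: "v \<in> pverts graph \<Longrightarrow> f v \<in> l1_space"
    and lower: "u \<in> pverts graph \<Longrightarrow> v \<in> pverts graph \<Longrightarrow>
      sp_dist (\<lambda>_. 1) graph u v \<le> \<tau> * l1_dist (f u) (f v)"
    and upper: "(u, v) \<in> parcs graph \<Longrightarrow> l1_dist (f u) (f v) \<le> \<rho>"
begin

section \<open>Averages over positions and selections\<close>

definition g :: "int \<Rightarrow> int \<Rightarrow> (nat \<times> bool \<times> bool) set \<Rightarrow> nat \<Rightarrow> real" where
  "g x y A = f (to_nat (lift x y A))"

lemma g_l1: "g x y A \<in> l1_space"
  unfolding g_def using is_point_lift by (intro f_l1) (auto simp: pverts_graph)

lemma g_period: "g (x + 2 * N) y A = g x y A" "g x (y + 2 * N) A = g x y A"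
  by (simp_all add: g_def lift_period_x lift_period_y)

lemma g_Lipschitz_nat:
  "l1_dist (g (x + int k) y A) (g x y A) \<le> \<rho> * k" "l1_dist (g x (y + int k) A) (g x y A) \<le> \<rho> * k"
proof (induct k)
  case 0
  { case 1 show ?case by (simp add: l1_norm_def) }
  { case 2 show ?case by (simp add: l1_norm_def) }
next
  case (Suc k)
  { case 1
    have "l1_dist (g (x + int k + 1) y A) (g (x + int k) y A) \<le> \<rho>"
      unfolding g_def using near_lift_x near_sym is_point_lift by (intro upper) (simp add: parcs_graph)
    then show ?case
      using Suc(1) l1_dist_triangle[OF g_l1 g_l1 g_l1, of "x + int k + 1" y A x y A "x + int k" y A]
      by (simp add: algebra_simps) }
  { case 2
    have "l1_dist (g x (y + int k + 1) A) (g x (y + int k) A) \<le> \<rho>"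
      unfolding g_def using near_lift_y near_sym is_point_lift by (intro upper) (simp add: parcs_graph)
    then show ?case
      using Suc(2) l1_dist_triangle[OF g_l1 g_l1 g_l1, of x "y + int k + 1" A x y A x "y + int k" A]
      by (simp add: algebra_simps) }
qed

lemma g_Lipschitz: "l1_dist (g (x + s) (y + t) A) (g x y A) \<le> \<rho> * (\<bar>s\<bar> + \<bar>t\<bar>)"
proof -
  have 1: "l1_dist (g (x + s) y A) (g x y A) \<le> \<rho> * \<bar>s\<bar>" for x y s
    using g_Lipschitz_nat(1)[of x "nat s" y A] g_Lipschitz_nat(1)[of "x + s" "nat (- s)" y A]
    by (cases "0 \<le> s") (auto simp: l1_dist_commute)
  have 2: "l1_dist (g x (y + t) A) (g x y A) \<le> \<rho> * \<bar>t\<bar>" for x y t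
    using g_Lipschitz_nat(2)[of x y "nat t" A] g_Lipschitz_nat(2)[of x "y + t" "nat (- t)" A]
    by (cases "0 \<le> t") (auto simp: l1_dist_commute)
  show ?thesis
    using l1_dist_triangle[OF g_l1 g_l1 g_l1, of "x + s" "y + t" A x y A x "y + t" A]
      1[of x s "y + t"] 2[of x y t]
    by (simp add: algebra_simps)
qed

definition selections :: "(nat \<times> bool \<times> bool) set set" where
  "selections = Pow ({..<M} \<times> UNIV)"

lemma selections_pos: "0 < card selections"
  by (auto simp: selections_def card_gt_0_iff)

text \<open>An expectation without normalisation, over a random position in one period and a random
  selection of sheets.\<close>

definition total :: "(int \<Rightarrow> int \<Rightarrow> (nat \<times> bool \<times> bool) set \<Rightarrow> real) \<Rightarrow> real" where
  "total h = (\<Sum>x\<in>{0..<2 * N}. \<Sum>y\<in>{0..<2 * N}. \<Sum>A\<in>selections. h x y A)"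

lemma total_shift:
  assumes "\<And>x y A. h (x + 2 * N) y A = h x y A" "\<And>x y A. h x (y + 2 * N) A = h x y A"
  shows "total (\<lambda>x y. h (x + s) (y + t)) = total h"
  unfolding total_def using assms side_pos[of M]
  by (intro sum2_shift_periodic[where h="\<lambda>x y. \<Sum>A\<in>selections. h x y A"]) auto

lemma total_sum: "total (\<lambda>x y A. \<Sum>j\<in>J. h j x y A) = (\<Sum>j\<in>J. total (h j))"
  by (induct J rule: infinite_finite_induct) (simp_all add: total_def sum.distrib)

definition stretch :: "int \<Rightarrow> int \<Rightarrow> real" where
  "stretch s t = total (\<lambda>x y A. l1_dist (g (x + s) (y + t) A) (g x y A))"

lemma stretch_shift:
  "total (\<lambda>x y A. l1_dist (g (x + p + s) (y + q + t) A) (g (x + p) (y + q) A)) = stretch s t"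
proof -
  have "g (x + 2 * N + s) y A = g (x + s) y A" "g x (y + 2 * N + t) A = g x (y + t) A" for x y A
    using g_period(1)[of "x + s"] g_period(2)[of x "y + t"] by (simp_all add: algebra_simps)
  then show ?thesis
    unfolding stretch_def
    using g_period by (intro total_shift[where h="\<lambda>x y A. l1_dist (g (x + s) (y + t) A) (g x y A)"]) auto
qed

definition excess where
  "excess s t x y A = l1_dist (g (x - s) (y - t) A) (g x y A) + l1_dist (g x y A) (g (x + s) (y + t) A)
    - l1_dist (g (x - s) (y - t) A) (g (x + s) (y + t) A)"

lemma excess_nonneg: "0 \<le> excess s t x y A"
  unfolding excess_def using l1_dist_triangle[OF g_l1 g_l1 g_l1] by simp

text \<open>By translation invariance each half of the chord contributes \<open>stretch s t\<close>
  and the whole chord \<open>stretch (2 * s) (2 * t)\<close>. Doubling a chord passes to the next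
  scale, which lets the sums telescope.\<close>

lemma total_excess: "total (\<lambda>x y. excess s t (x + p) (y + q)) = 2 * stretch s t - stretch (2 * s) (2 * t)"
proof -
  have "total (\<lambda>x y. excess s t (x + p) (y + q)) =
      total (\<lambda>x y A. l1_dist (g (x + (p - s) + s) (y + (q - t) + t) A) (g (x + (p - s)) (y + (q - t)) A))
      + total (\<lambda>x y A. l1_dist (g (x + p + s) (y + q + t) A) (g (x + p) (y + q) A))
      - total (\<lambda>x y A. l1_dist (g (x + (p - s) + 2 * s) (y + (q - t) + 2 * t) A) (g (x + (p - s)) (y + (q - t)) A))"
    unfolding total_def sum_subtractf[symmetric] sum.distrib[symmetric]
    by (intro sum.cong refl) (simp add: excess_def l1_dist_commute algebra_simps, rule l1_dist_commute)
  then show ?thesis unfolding stretch_shift by simp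
qed

text \<open>
  The chords run around half of the boundary of a box: first along its bottom side, then up its
  right side. Successive chords alternate between a centre and its translate by one step along
  the current side, so that every chord shares one endpoint with its successor.
\<close>

definition chord_x :: "nat \<Rightarrow> int" where "chord_x j = min (int j - n) n"

definition chord_y :: "nat \<Rightarrow> int" where "chord_y j = max (- n) (int j - 3 * n)"

definition centre :: "nat \<Rightarrow> nat" where
  "centre j = (if even j then 0 else if int j < 2 * n then 1 else 2)"

definition shift_x :: "nat \<Rightarrow> int" where "shift_x s = of_bool (s = 1)"

definition shift_y :: "nat \<Rightarrow> int" where "shift_y s = of_bool (s = 2)"

abbreviation L :: nat where "L \<equiv> 2 * nat n"

text \<open>For an odd index with chord vector \<open>v\<close> and centre translated by a unit step
  \<open>u\<close>, the ends \<open>u - v\<close> and \<open>u + v\<close> are an end of the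
  previous and of the next chord. The corner of the box has the even index \<open>2 * n\<close>, so
  \<open>u\<close> is constant on each such triple.\<close>

lemma chords_odd:
  "shift_x (centre (2 * k + 1)) - chord_x (2 * k + 1) = shift_x (centre (2 * k)) - chord_x (2 * k)"
  "shift_y (centre (2 * k + 1)) - chord_y (2 * k + 1) = shift_y (centre (2 * k)) - chord_y (2 * k)"
  "shift_x (centre (2 * k + 1)) + chord_x (2 * k + 1) = shift_x (centre (2 * k + 2)) + chord_x (2 * k + 2)"
  "shift_y (centre (2 * k + 1)) + chord_y (2 * k + 1) = shift_y (centre (2 * k + 2)) + chord_y (2 * k + 2)"
  by (auto simp: chord_x_def chord_y_def centre_def shift_x_def shift_y_def min_def max_def) presburger

lemma chords_ends: "chord_x 0 = - n" "chord_y 0 = - n" "chord_x (2 * L) = n" "chord_y (2 * L) = n"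
  using n_pos by (auto simp: chord_x_def chord_y_def)

text \<open>At scale \<open>2 ^ i\<close> the ends of a chord are thus exactly one side away from
  its centre in some coordinate, hence in a square of another parity.\<close>

lemma chord_sup: "chord_x j = n \<or> chord_y j = - n"
  by (auto simp: chord_x_def chord_y_def min_def max_def)

lemma chord_bound: "j \<le> 2 * L \<Longrightarrow> \<bar>chord_x j\<bar> \<le> n \<and> \<bar>chord_y j\<bar> \<le> n"
  using n_pos by (auto simp: chord_x_def chord_y_def)

definition flip :: "nat \<Rightarrow> int \<Rightarrow> int \<Rightarrow> (nat \<times> bool \<times> bool) set \<Rightarrow> (nat \<times> bool \<times> bool) set" where
  "flip i x y A = (if parity i x y \<in> A then A - {parity i x y} else insert (parity i x y) A)"

lemma sum_flip:
  assumes "i < M"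
  shows "(\<Sum>A\<in>selections. h (flip i x y A)) = (\<Sum>A\<in>selections. h A)"
  by (rule sum.reindex_bij_witness[where i="flip i x y" and j="flip i x y"])
    (use assms in \<open>auto simp: flip_def selections_def parity_def\<close>)

lemma g_flip:
  assumes "parity i x' y' \<noteq> parity i x y"
  shows "g x' y' (flip i x y A) = g x' y' A"
  unfolding g_def
proof (rule arg_cong[where f="\<lambda>p. f (to_nat p)"], rule lift_cong)
  fix j
  have "parity j x' y' \<noteq> parity i x y" using assms by (cases "j = i") (auto simp: parity_def)
  then show "parity j x' y' \<in> flip i x y A \<longleftrightarrow> parity j x' y' \<in> A" by (auto simp: flip_def)
qed

text \<open>Here the lines of level \<open>i\<close> are at least a quarter of the side away, which
  also leaves room for the translates by \<open>2 ^ i\<close>.\<close>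

definition middle :: "nat \<Rightarrow> int set" where
  "middle i = {x \<in> {0..<2 * N}. side i div 4 \<le> x mod side i \<and> x mod side i < 3 * (side i div 4)}"

lemma side_4: "side i = 4 * (side i div 4)" "2 ^ i \<le> side i div 4"
proof -
  obtain q where q: "n = 4 * q" using four_dvd_n by auto
  have s: "side i = 4 * (q * 2 ^ i)" unfolding side_def unfolding q by simp
  then show "side i = 4 * (side i div 4)" by simp
  have "1 \<le> q" using n_pos unfolding q by simp
  then show "2 ^ i \<le> side i div 4" unfolding s by simp
qed

lemma card_middle:
  assumes "i < M"
  shows "real (card (middle i)) = real_of_int N"
proof -
  have "4 dvd side i" using side_4(1)[of i] by (metis dvd_triv_left)
  then show ?thesis
    using card_middle_half[of "side i" "2 * N"] side_pos side_dvd_side[of i M] assms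
    unfolding middle_def by simp
qed

lemma middle_div:
  assumes "x \<in> middle i"
  shows "(x + 2 ^ i) div side i = x div side i"
proof -
  have "0 \<le> x mod side i + 2 ^ i" "x mod side i + 2 ^ i < side i"
    using assms side_4[of i] pos_mod_sign[OF side_pos, of x i] unfolding middle_def by auto
  moreover have "x + 2 ^ i = side i * (x div side i) + (x mod side i + 2 ^ i)"
    using mult_div_mod_eq[of "side i" x] by linarith
  ultimately show ?thesis by (intro int_div_pos_eq)
qed

lemma middle_line_dist:
  assumes "x \<in> middle i"
  shows "side i div 4 \<le> line_dist (side i) x"
  using assms side_4(1)[of i] unfolding middle_def line_dist_def by auto

lemma sheets_apart:
  assumes i: "i < M" and x: "x \<in> middle i" and y: "y \<in> middle i"
  shows "side i / (2 * \<tau>) \<le> l1_dist (g x y A) (g x y (flip i x y A))"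
proof -
  let ?b = "\<lambda>A. map (\<lambda>j. inner j x y \<and> parity j x y \<in> A) [0..<M]"
  have pos: "0 < side i div 4" using side_4(1)[of i] side_pos[of i] by linarith
  have "0 < line_dist (side i) x" "0 < line_dist (side i) y"
    using pos middle_line_dist x y by fastforce+
  then have "inner i x y" 
    using line_dist_eq_0_iff[OF side_pos, of i x] line_dist_eq_0_iff[OF side_pos, of i y]
    unfolding inner_def by auto
  then have "?b A ! i \<noteq> ?b (flip i x y A) ! i" using i by (auto simp: flip_def)
  then have "2 * min (line_dist (side i) (fold_line x)) (line_dist (side i) (fold_line y))
      \<le> sp_dist (\<lambda>_. 1) graph (to_nat (lift x y A)) (to_nat (lift x y (flip i x y A)))"
    using is_point_lift[of x y A] is_point_lift[of x y "flip i x y A"] sheet_dist[OF i]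
    unfolding lift_def by blast
  also have "\<dots> \<le> \<tau> * l1_dist (g x y A) (g x y (flip i x y A))"
    unfolding g_def using is_point_lift by (intro lower) (auto simp: pverts_graph)
  finally have d: "2 * min (line_dist (side i) x) (line_dist (side i) y)
      \<le> \<tau> * l1_dist (g x y A) (g x y (flip i x y A))"
    using i by (simp add: line_dist_fold_line)
  have "side i div 4 \<le> min (line_dist (side i) x) (line_dist (side i) y)"
    using middle_line_dist x y by simp
  then have "2 * (side i div 4) \<le> 2 * min (line_dist (side i) x) (line_dist (side i) y)" by simp
  then have "real_of_int (2 * (side i div 4)) \<le> \<tau> * l1_dist (g x y A) (g x y (flip i x y A))"
    using d by linarith
  moreover have "real_of_int (side i) = 2 * real_of_int (2 * (side i div 4))"
    using side_4(1)[of i] by linarith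
  ultimately show ?thesis using \<tau>_ge_1 by (simp add: field_simps)
qed

text \<open>The chain of chords is applied at scale \<open>2 ^ i\<close>. The ends have another
  parity, so they are the same for both selections, while the centres are the two copies. Four
  translates, each within \<open>\<rho> * 2 ^ i\<close> of its centre, enter with factor 2, which
  gives \<open>8 * \<rho> * 2 ^ i\<close>.\<close>

lemma sheets_apart_le_excess:
  assumes i: "i < M" and x: "x \<in> middle i" and y: "y \<in> middle i"
  defines "E \<equiv> \<lambda>j x y. excess (2 ^ i * chord_x j) (2 ^ i * chord_y j)
    (x + 2 ^ i * shift_x (centre j)) (y + 2 ^ i * shift_y (centre j))"
  shows "l1_dist (g x y A) (g x y (flip i x y A)) \<le>
    (\<Sum>j\<le>2 * L. E j x y A + E j x y (flip i x y A)) + 8 * \<rho> * 2 ^ i"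
proof -
  let ?h = "2 ^ i :: int" and ?A = "flip i x y A"
  define a where "a j = g (x + ?h * (shift_x (centre j) - chord_x j)) (y + ?h * (shift_y (centre j) - chord_y j)) A" for j
  define b where "b j = g (x + ?h * (shift_x (centre j) + chord_x j)) (y + ?h * (shift_y (centre j) + chord_y j)) A" for j
  define z where "z s = g (x + ?h * shift_x s) (y + ?h * shift_y s) A" for s
  define z' where "z' s = g (x + ?h * shift_x s) (y + ?h * shift_y s) ?A" for s
  have div_shift: "(x + ?h * shift_x s) div side i = x div side i" "(y + ?h * shift_y s) div side i = y div side i" for s
    using middle_div x y by (auto simp: shift_x_def shift_y_def)
  have side: "?h * n = side i" by (simp add: side_def)
  have par: "parity i (x + ?h * shift_x s + \<epsilon> * (?h * chord_x j)) (y + ?h * shift_y s + \<epsilon> * (?h * chord_y j)) \<noteq> parity i x y"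
    if "\<epsilon> = 1 \<or> \<epsilon> = - 1" for \<epsilon> :: int and s j
  proof -
    have odd: "odd ((u + \<delta> * side i) div side i) \<noteq> odd (u div side i)" if "\<delta> = 1 \<or> \<delta> = - 1" for u \<delta> :: int
      using that side_pos[of i] by auto
    have "\<exists>\<delta>. (\<delta> = 1 \<or> \<delta> = - 1) \<and> (\<epsilon> * (?h * chord_x j) = \<delta> * side i \<or> \<epsilon> * (?h * chord_y j) = \<delta> * side i)"
      using chord_sup[of j] that side by (metis minus_mult_commute mult_minus_right minus_minus)
    then show ?thesis using odd div_shift unfolding parity_def by (metis prod.inject)
  qed
  have a_flip: "a j = g (x + ?h * (shift_x (centre j) - chord_x j)) (y + ?h * (shift_y (centre j) - chord_y j)) ?A" for j
    using g_flip[OF par[of "- 1" "centre j" j], of A] unfolding a_def by (simp add: algebra_simps)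
  have b_flip: "b j = g (x + ?h * (shift_x (centre j) + chord_x j)) (y + ?h * (shift_y (centre j) + chord_y j)) ?A" for j
    using g_flip[OF par[of 1 "centre j" j], of A] unfolding b_def by (simp add: algebra_simps)
  have "l1_dist (z 0) (z' 0) \<le> (\<Sum>j\<le>2 * L.
      l1_dist (a j) (z (centre j)) + l1_dist (z (centre j)) (b j) - l1_dist (a j) (b j)
      + (l1_dist (a j) (z' (centre j)) + l1_dist (z' (centre j)) (b j) - l1_dist (a j) (b j)))
    + 2 * (l1_dist (z 1) (z 0) + l1_dist (z 2) (z 0) + l1_dist (z' 1) (z' 0) + l1_dist (z' 2) (z' 0))"
  proof (rule chord_chain_l1)
    show "a (2 * k + 1) = a (2 * k)" "b (2 * k + 1) = b (2 * k + 2)" for k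
      unfolding a_def b_def by (simp_all only: chords_odd)
    show "b (2 * L) = a 0"
      unfolding a_def b_def chords_ends by (simp add: centre_def shift_x_def shift_y_def)
    show "centre j \<le> 2" for j by (simp add: centre_def)
  qed (simp_all add: a_def b_def z_def z'_def g_l1)
  moreover have "l1_dist (a j) (z (centre j)) + l1_dist (z (centre j)) (b j) - l1_dist (a j) (b j) = E j x y A" for j
    unfolding a_def b_def z_def E_def excess_def by (simp add: algebra_simps)
  moreover have "l1_dist (a j) (z' (centre j)) + l1_dist (z' (centre j)) (b j) - l1_dist (a j) (b j) = E j x y ?A" for j
    unfolding a_flip b_flip z'_def E_def excess_def by (simp add: algebra_simps)
  moreover have "l1_dist (g (x + ?h * shift_x s) (y + ?h * shift_y s) B)
      (g (x + ?h * shift_x 0) (y + ?h * shift_y 0) B) \<le> \<rho> * 2 ^ i" if "s = 1 \<or> s = 2" for s B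
    using g_Lipschitz[of x "?h * shift_x s" y "?h * shift_y s" B] that
    by (auto simp: shift_x_def shift_y_def)
  then have "l1_dist (z s) (z 0) \<le> \<rho> * 2 ^ i" "l1_dist (z' s) (z' 0) \<le> \<rho> * 2 ^ i" if "s = 1 \<or> s = 2" for s
    using that unfolding z_def z'_def by blast+
  then have "l1_dist (z 1) (z 0) \<le> \<rho> * 2 ^ i" "l1_dist (z' 1) (z' 0) \<le> \<rho> * 2 ^ i"
    "l1_dist (z 2) (z 0) \<le> \<rho> * 2 ^ i" "l1_dist (z' 2) (z' 0) \<le> \<rho> * 2 ^ i"
    by auto
  moreover have "z 0 = g x y A" "z' 0 = g x y ?A" by (simp_all add: z_def z'_def shift_x_def shift_y_def)
  ultimately show ?thesis by simp
qed

section \<open>Telescoping over the scales\<close>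

text \<open>Dividing by \<open>2 ^ i\<close> turns the total excess at scale \<open>i\<close> into a
  multiple of a difference of consecutive values.\<close>

definition scale_stretch :: "nat \<Rightarrow> real" where
  "scale_stretch i = (\<Sum>j\<le>2 * L. stretch (2 ^ i * chord_x j) (2 ^ i * chord_y j)) / 2 ^ i"

lemma scale_stretch_drop:
  assumes i: "i < M"
  shows "real_of_int N ^ 2 * card selections * (n / (2 * \<tau>) - 8 * \<rho>) \<le> 4 * (scale_stretch i - scale_stretch (Suc i))"
proof -
  let ?K = "middle i"
  define E where "E j x y = excess (2 ^ i * chord_x j) (2 ^ i * chord_y j)
    (x + 2 ^ i * shift_x (centre j)) (y + 2 ^ i * shift_y (centre j))" for j x y
  have E_nonneg: "0 \<le> E j x y A" for j x y A unfolding E_def by (rule excess_nonneg)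
  \<comment> \<open>The middle takes up \<open>N\<close> of the \<open>2 * N\<close> values of each
    coordinate.\<close>
  have "real_of_int N ^ 2 * card selections * (side i / (2 * \<tau>)) =
      (\<Sum>x\<in>?K. \<Sum>y\<in>?K. \<Sum>A\<in>selections. side i / (2 * \<tau>))"
    using card_middle[OF i] by (simp add: power2_eq_square)
  also have "\<dots> \<le> (\<Sum>x\<in>?K. \<Sum>y\<in>?K. \<Sum>A\<in>selections.
      (\<Sum>j\<le>2 * L. E j x y A + E j x y (flip i x y A)) + 8 * \<rho> * 2 ^ i)"
  proof (intro sum_mono)
    fix x y A assume xy: "x \<in> ?K" "y \<in> ?K"
    show "side i / (2 * \<tau>) \<le> (\<Sum>j\<le>2 * L. E j x y A + E j x y (flip i x y A)) + 8 * \<rho> * 2 ^ i"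
      using sheets_apart[OF i xy, of A] sheets_apart_le_excess[OF i xy, of A] unfolding E_def by linarith
  qed
  also have "\<dots> = (\<Sum>x\<in>?K. \<Sum>y\<in>?K. \<Sum>A\<in>selections. \<Sum>j\<le>2 * L. E j x y A + E j x y (flip i x y A))
      + real_of_int N ^ 2 * card selections * (8 * \<rho> * 2 ^ i)"
    using card_middle[OF i] by (simp add: sum.distrib power2_eq_square algebra_simps)
  \<comment> \<open>The flip permutes the selections, so both copies contribute the same
    sum.\<close>
  also have "(\<Sum>x\<in>?K. \<Sum>y\<in>?K. \<Sum>A\<in>selections. \<Sum>j\<le>2 * L. E j x y A + E j x y (flip i x y A))
      = (\<Sum>x\<in>?K. \<Sum>y\<in>?K. 2 * (\<Sum>A\<in>selections. \<Sum>j\<le>2 * L. E j x y A))"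
    using sum_flip[OF i, of "\<lambda>A. \<Sum>j\<le>2 * L. E j _ _ A"] by (simp add: sum.distrib)
  \<comment> \<open>The excess is nonnegative, so the sums may be extended to the whole period,
    where translation invariance applies.\<close>
  also have "\<dots> \<le> (\<Sum>x\<in>?K. \<Sum>y\<in>{0..<2 * N}. 2 * (\<Sum>A\<in>selections. \<Sum>j\<le>2 * L. E j x y A))"
    by (intro sum_mono sum_mono2) (auto simp: middle_def intro!: sum_nonneg E_nonneg)
  also have "\<dots> \<le> (\<Sum>x\<in>{0..<2 * N}. \<Sum>y\<in>{0..<2 * N}. 2 * (\<Sum>A\<in>selections. \<Sum>j\<le>2 * L. E j x y A))"
    by (intro sum_mono2) (auto simp: middle_def intro!: sum_nonneg E_nonneg)
  also have "\<dots> = 2 * total (\<lambda>x y A. \<Sum>j\<le>2 * L. E j x y A)"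
    by (simp add: total_def sum_distrib_left)
  also have "total (\<lambda>x y A. \<Sum>j\<le>2 * L. E j x y A) = (\<Sum>j\<le>2 * L. total (E j))"
    by (rule total_sum)
  also have "(\<Sum>j\<le>2 * L. total (E j)) = (\<Sum>j\<le>2 * L. 2 * stretch (2 ^ i * chord_x j) (2 ^ i * chord_y j)
      - stretch (2 ^ Suc i * chord_x j) (2 ^ Suc i * chord_y j))"
    unfolding E_def total_excess by (simp add: mult.assoc)
  also have "\<dots> = 2 * 2 ^ i * (scale_stretch i - scale_stretch (Suc i))"
    by (simp add: scale_stretch_def sum_subtractf sum_distrib_left field_simps)
  finally have "real_of_int N ^ 2 * card selections * (side i / (2 * \<tau>) - 8 * \<rho> * 2 ^ i)
      \<le> 2 ^ i * (4 * (scale_stretch i - scale_stretch (Suc i)))"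
    by (simp add: algebra_simps)
  moreover have "side i / (2 * \<tau>) - 8 * \<rho> * 2 ^ i = 2 ^ i * (n / (2 * \<tau>) - 8 * \<rho>)"
    by (simp add: side_def field_simps)
  ultimately have "2 ^ i * (real_of_int N ^ 2 * card selections * (n / (2 * \<tau>) - 8 * \<rho>))
      \<le> 2 ^ i * (4 * (scale_stretch i - scale_stretch (Suc i)))"
    by (simp add: mult_ac)
  then show ?thesis by (rule mult_left_le_imp_le) simp
qed

lemma stretch_nonneg: "0 \<le> stretch s t"
  unfolding stretch_def total_def by (intro sum_nonneg l1_dist_nonneg g_l1)

text \<open>There are \<open>4 * n + 1\<close> chord vectors, each of length at most
  \<open>2 * n\<close> in the grid; the remaining factor 4 comes from the \<open>(2 * N) ^ 2\<close>
  positions.\<close>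

lemma scale_stretch_0: "scale_stretch 0 \<le> (4 * n + 1) * (8 * n * \<rho> * (real_of_int N ^ 2 * card selections))"
proof -
  have "stretch (chord_x j) (chord_y j) \<le> 8 * n * \<rho> * (real_of_int N ^ 2 * card selections)" if j: "j \<le> 2 * L" for j
  proof -
    have "stretch (chord_x j) (chord_y j) \<le> total (\<lambda>_ _ _. \<rho> * (2 * n))"
      unfolding stretch_def total_def
    proof (intro sum_mono)
      fix x y A
      have "real_of_int (\<bar>chord_x j\<bar> + \<bar>chord_y j\<bar>) \<le> 2 * n" using chord_bound[OF j] by linarith
      then have "\<rho> * (\<bar>chord_x j\<bar> + \<bar>chord_y j\<bar>) \<le> \<rho> * (2 * n)"
        using \<rho>_ge_1 by (intro mult_left_mono) auto
      then show "l1_dist (g (x + chord_x j) (y + chord_y j) A) (g x y A) \<le> \<rho> * (2 * n)"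
        using g_Lipschitz[of x "chord_x j" y "chord_y j" A] by linarith
    qed
    also have "\<dots> = 8 * n * \<rho> * (real_of_int N ^ 2 * card selections)"
      using side_pos[of M] by (simp add: total_def power2_eq_square)
    finally show ?thesis .
  qed
  then have "(\<Sum>j\<le>2 * L. stretch (chord_x j) (chord_y j))
      \<le> (\<Sum>j\<le>2 * L. 8 * n * \<rho> * (real_of_int N ^ 2 * card selections))"
    by (intro sum_mono) auto
  then show ?thesis using n_pos by (simp add: scale_stretch_def add.commute)
qed

text \<open>The drops over \<open>M\<close> levels add up to at most the initial value. The
  hypothesis keeps the error \<open>8 * \<rho>\<close> to at most half of the gain
  \<open>n / (2 * \<tau>)\<close>.\<close>

lemma levels_le_distortion:
  assumes n: "32 * \<tau> * \<rho> \<le> n"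
  shows "M \<le> 640 * n * \<tau> * \<rho>"
proof -
  define Z where "Z = real_of_int N ^ 2 * card selections"
  have Z: "0 < Z" using side_pos[of M] selections_pos by (simp add: Z_def)
  have n1: "1 \<le> n" using n_pos by simp
  have "m \<le> M \<Longrightarrow> m * (Z * (n / (2 * \<tau>) - 8 * \<rho>)) \<le> 4 * (scale_stretch 0 - scale_stretch m)" for m
  proof (induct m)
    case (Suc m)
    define W where "W = Z * (n / (2 * \<tau>) - 8 * \<rho>)"
    have "W \<le> 4 * (scale_stretch m - scale_stretch (Suc m))"
      using scale_stretch_drop[of m] Suc unfolding W_def Z_def by simp
    then show ?case using Suc unfolding W_def[symmetric] by (simp add: algebra_simps)
  qed simp
  then have "M * (Z * (n / (2 * \<tau>) - 8 * \<rho>)) \<le> 4 * (scale_stretch 0 - scale_stretch M)" by simp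
  also have "\<dots> \<le> 4 * scale_stretch 0"
    using stretch_nonneg by (simp add: scale_stretch_def sum_nonneg)
  also have "\<dots> \<le> 4 * ((4 * n + 1) * (8 * n * \<rho> * Z))" using scale_stretch_0 unfolding Z_def by (intro mult_left_mono) auto
  also have "\<dots> \<le> 4 * ((5 * n) * (8 * n * \<rho> * Z))"
    using n1 Z \<rho>_ge_1 by (intro mult_left_mono mult_right_mono) auto
  finally have "Z * (M * (n / (2 * \<tau>) - 8 * \<rho>)) \<le> Z * (160 * n * n * \<rho>)"
    by (simp add: algebra_simps)
  then have M: "M * (n / (2 * \<tau>) - 8 * \<rho>) \<le> 160 * n * n * \<rho>"
    using Z by (rule mult_left_le_imp_le)
  have "8 * \<rho> \<le> n / (4 * \<tau>)" using n \<tau>_ge_1 by (simp add: field_simps)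
  moreover have "n / (2 * \<tau>) = n / (4 * \<tau>) + n / (4 * \<tau>)" by (simp add: field_simps)
  ultimately have "n / (4 * \<tau>) \<le> n / (2 * \<tau>) - 8 * \<rho>" by linarith
  then have "M * (n / (4 * \<tau>)) \<le> 160 * n * n * \<rho>"
    using M mult_left_mono[of "n / (4 * \<tau>)" "n / (2 * \<tau>) - 8 * \<rho>" "real M"] by linarith
  then have "n * real M \<le> n * (640 * n * \<tau> * \<rho>)"
    using \<tau>_ge_1 by (simp add: field_simps)
  then show ?thesis by (rule mult_left_le_imp_le) (use n_pos in simp)
qed

end

section \<open>The lower bound\<close>

text \<open>An empty set has infimum \<infinity>, and the other factor is at least 1, so the product
  is infinite. Otherwise the bound passes to the infima one factor at a time.\<close>

lemma INF_mult_INF_ge: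
  fixes A B :: "real set"
  assumes A: "\<And>a. a \<in> A \<Longrightarrow> 1 \<le> a" and B: "\<And>b. b \<in> B \<Longrightarrow> 1 \<le> b"
    and c: "\<And>a b. a \<in> A \<Longrightarrow> b \<in> B \<Longrightarrow> c \<le> a * b"
  shows "ereal c \<le> (INF a\<in>A. ereal a) * (INF b\<in>B. ereal b)"
proof -
  have 1: "1 \<le> (INF a\<in>A. ereal a)" "1 \<le> (INF b\<in>B. ereal b)"
    using A B by (auto intro!: INF_greatest simp: one_ereal_def)
  then have pos: "0 < (INF a\<in>A. ereal a)" "0 < (INF b\<in>B. ereal b)"
    by (auto intro: less_le_trans[of 0 "1 :: ereal"])
  show ?thesis
  proof (cases "A = {} \<or> B = {}")
    case True
    then have "(INF a\<in>A. ereal a) * (INF b\<in>B. ereal b) = \<infinity>"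
      using pos by (auto simp: top_ereal_def)
    then show ?thesis by (simp only: ereal_less_eq)
  next
    case False
    have bdd: "bdd_below A" "bdd_below B" by (rule bdd_belowI[of _ 1], fact A B)+
    have I1: "1 \<le> Inf A" using A False by (intro cInf_greatest) auto
    have "c \<le> Inf A * b" if b: "b \<in> B" for b
    proof -
      have "c / b \<le> Inf A"
        using False c[OF _ b] B[OF b] by (intro cInf_greatest) (auto simp: field_simps)
      then show ?thesis using B[OF b] by (simp add: field_simps)
    qed
    then have "c / Inf A \<le> Inf B"
      using False I1 by (intro cInf_greatest) (auto simp: field_simps)
    then have "c \<le> Inf A * Inf B" using I1 by (simp add: field_simps)
    moreover have "(INF a\<in>A. ereal a) = ereal (Inf A)" "(INF b\<in>B. ereal b) = ereal (Inf B)"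
      using ereal_Inf'[OF bdd(1)] ereal_Inf'[OF bdd(2)] False by auto
    ultimately show ?thesis by simp
  qed
qed

text \<open>If \<open>\<tau> * \<rho>\<close> were smaller, then
  \<open>32 * \<tau> * \<rho> \<le> n\<close>, and \<open>M \<le> 640 * n * \<tau> * \<rho>\<close>
  with \<open>n \<le> 8 * sqrt M\<close> would give \<open>M < M\<close>, as
  \<open>5120 = 640 * 8\<close>.\<close>

lemma (in nested_squares) distortion_graph_ge:
  assumes n: "4 dvd n" "4 * sqrt M \<le> n" "n \<le> 8 * sqrt M" and "1 \<le> M"
    and f: "\<And>v. v \<in> pverts graph \<Longrightarrow> f v \<in> l1_space"
  shows "ereal (sqrt M / 5120) \<le> distortion (\<lambda>_. 1) graph f"
  unfolding distortion_def contraction_def expansion_def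
proof (rule INF_mult_INF_ge)
  fix \<tau> \<rho> :: real
  assume "\<tau> \<in> {\<tau>. 1 \<le> \<tau> \<and> (\<forall>x\<in>pverts graph. \<forall>y\<in>pverts graph.
      1 / \<tau> * sp_dist (\<lambda>_. 1) graph x y \<le> l1_dist (f x) (f y))}"
    and "\<rho> \<in> {\<rho>. 1 \<le> \<rho> \<and> (\<forall>x\<in>pverts graph. \<forall>y\<in>pverts graph.
      l1_dist (f x) (f y) \<le> \<rho> * sp_dist (\<lambda>_. 1) graph x y)}"
  then have \<tau>: "1 \<le> \<tau>" "\<And>x y. x \<in> pverts graph \<Longrightarrow> y \<in> pverts graph \<Longrightarrow>
      1 / \<tau> * sp_dist (\<lambda>_. 1) graph x y \<le> l1_dist (f x) (f y)"
    and \<rho>: "1 \<le> \<rho>" "\<And>x y. x \<in> pverts graph \<Longrightarrow> y \<in> pverts graph \<Longrightarrow>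
      l1_dist (f x) (f y) \<le> \<rho> * sp_dist (\<lambda>_. 1) graph x y"
    by blast+
  interpret embedded_squares n M f \<tau> \<rho>
  proof unfold_locales
    show "sp_dist (\<lambda>_. 1) graph u v \<le> \<tau> * l1_dist (f u) (f v)"
      if "u \<in> pverts graph" "v \<in> pverts graph" for u v
      using \<tau>(2)[OF that] \<tau>(1) by (simp add: field_simps)
    show "l1_dist (f u) (f v) \<le> \<rho>" if uv: "(u, v) \<in> parcs graph" for u v
    proof -
      have "\<rho> * sp_dist (\<lambda>_. 1) graph u v \<le> \<rho> * 1"
        using sp_dist_adjacent[OF uv] \<rho>(1) by (intro mult_left_mono) auto
      then show ?thesis using \<rho>(2)[of u v] in_arcsD1[OF uv] in_arcsD2[OF uv] by simp
    qed
  qed (use n \<tau> \<rho> f in auto)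
  show "sqrt M / 5120 \<le> \<tau> * \<rho>"
  proof (rule ccontr)
    assume "\<not> ?thesis"
    then have small: "\<tau> * \<rho> < sqrt M / 5120" by simp
    have pos: "0 < sqrt M" using \<open>1 \<le> M\<close> by simp
    then have "32 * (\<tau> * \<rho>) \<le> n" using small n(2) by linarith
    then have "32 * \<tau> * \<rho> \<le> n" by (simp add: mult.assoc)
    then have "M \<le> 640 * n * \<tau> * \<rho>" by (rule levels_le_distortion)
    also have "\<dots> = (640 * n) * (\<tau> * \<rho>)" by simp
    also have "\<dots> < (640 * n) * (sqrt M / 5120)" using small n_pos by (intro mult_strict_left_mono) auto
    also have "\<dots> \<le> (640 * (8 * sqrt M)) * (sqrt M / 5120)"
      using n(3) pos by (intro mult_right_mono) auto
    also have "\<dots> = M" by simp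
    finally show False by simp
  qed
qed auto

theorem theorem4:
  shows "\<exists>(C::nat) (c::real). 0 < c \<and>
    (\<forall>k::nat. 1 \<le> k \<longrightarrow>
      (\<exists>(G::nat pair_pre_digraph) w.
         weighted_graph G w \<and>
         spd_depth w (with_proj G) \<le> enat (C * k) \<and>
         (\<forall>f. (\<forall>v \<in> pverts G. f v \<in> l1_space) \<longrightarrow>
            ereal (c * sqrt (real k / ln (real k))) \<le> distortion w G f)))"
proof (intro exI[of _ "14 :: nat"] exI[of _ "1 / 10240 :: real"] conjI allI impI)
  fix k :: nat
  assume k: "1 \<le> k"
  define n where "n = 4 * \<lceil>sqrt k\<rceil>"
  have sqrt: "1 \<le> sqrt k" "sqrt k \<le> k" using k by (auto intro: real_le_lsqrt simp: power2_eq_square)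
  have n: "4 * sqrt k \<le> n" "n < 4 * sqrt k + 4" unfolding n_def by linarith+
  have n_upper: "n \<le> 8 * sqrt k" using n(2) sqrt(1) by linarith
  have four_dvd: "4 dvd n" by (simp add: n_def)
  interpret nested_squares n k
    using n(1) sqrt(1) by unfold_locales linarith
  \<comment> \<open>Since \<open>n < 4 * sqrt k + 4\<close> and \<open>sqrt k \<le> k\<close>, the
    left side is at most \<open>6 * k + 8\<close>, and \<open>1 \<le> k\<close>.\<close>
  have "nat n + 2 * k + 4 \<le> 14 * k" using n sqrt k by linarith
  then have depth: "spd_depth (\<lambda>_. 1) (with_proj graph) \<le> enat (14 * k)"
    using spd_depth_graph by (meson enat_ord_simps(1) order_trans)
  \<comment> \<open>For \<open>k \<ge> 2\<close> the logarithm is at least \<open>1 / 2\<close>; for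
    \<open>k = 1\<close> the division by \<open>ln 1 = 0\<close> gives 0. The factor 2 is the reason
    for \<open>10240 = 2 * 5120\<close>.\<close>
  have ln: "sqrt (k / ln k) \<le> 2 * sqrt k"
  proof (cases "k = 1")
    case False
    then have "ln 2 \<le> ln (real k)" using k by simp
    moreover have "ln (1 / 2 :: real) \<le> 1 / 2 - 1" by (rule ln_le_minus_one) simp
    then have "1 / 2 \<le> ln (2 :: real)" by (simp add: ln_div)
    ultimately have "1 / 2 \<le> ln (real k)" by linarith
    then have "k / ln k \<le> k / (1 / 2)" by (intro divide_left_mono) auto
    also have "\<dots> \<le> 4 * real k" by simp
    finally have "sqrt (k / ln k) \<le> sqrt (4 * real k)" by (rule real_sqrt_le_mono)
    then show ?thesis by (simp add: real_sqrt_mult)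
  qed simp
  show "\<exists>(G::nat pair_pre_digraph) w. weighted_graph G w \<and>
      spd_depth w (with_proj G) \<le> enat (14 * k) \<and>
      (\<forall>f. (\<forall>v \<in> pverts G. f v \<in> l1_space) \<longrightarrow>
        ereal (1 / 10240 * sqrt (real k / ln (real k))) \<le> distortion w G f)"
  proof (intro exI conjI allI impI)
    show "weighted_graph graph (\<lambda>_. 1)" by unfold_locales
    show "spd_depth (\<lambda>_. 1) (with_proj graph) \<le> enat (14 * k)" by (rule depth)
    fix f :: "nat \<Rightarrow> nat \<Rightarrow> real"
    assume f: "\<forall>v \<in> pverts graph. f v \<in> l1_space"
    have "1 / 10240 * sqrt (k / ln k) \<le> sqrt k / 5120" using ln by simp
    then have "ereal (1 / 10240 * sqrt (k / ln k)) \<le> ereal (sqrt k / 5120)" by simp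
    also have "\<dots> \<le> distortion (\<lambda>_. 1) graph f"
      using n(1) n_upper four_dvd f k by (intro distortion_graph_ge) auto
    finally show "ereal (1 / 10240 * sqrt (k / ln k)) \<le> distortion (\<lambda>_. 1) graph f" .
  qed
qed simp

end
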